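(* Let $N\ge1$, $\omega_1,\dots,\omega_N\in\mathbb{R}$, $\kappa>0$ and $\varepsilon\in(0,1]$ with $\kappa>(2+\varepsilon)\|\Omega\|_\infty$, where $\|\Omega\|_\infty=\max_i|\omega_i|$. For initial data $(\theta_i^0)_{i=1}^N$ let $(\theta_i(t))_{i=1}^N$ solve \[ \dot\theta_i=\omega_i-\frac{\kappa}{N}\sum_{j=1}^N(1+\cos\theta_j)\sin\theta_i,\qquad\theta_i(0)=\theta_i^0, \] and let $R(t)=\frac1N\sum_j(1+\cos\theta_j(t))$. Let $m$ be the normalized Lebesgue measure on $[-\pi,\pi]^N$ ($m([-\pi,\pi]^N)=1$). Then the $m$-measure of the set of initial data $(\theta_i^0)\in[-\pi,\pi]^N$ such that (i) $R(t)\ge\frac1{\sqrt2}-\frac{3\varepsilon}{20}$ for all $t\ge0$; (ii) $\sup_{t\ge0}\theta_i(t)-\inf_{t\ge0}\theta_i(t)<2\pi$ for all $i$; and (iii) for every $i$ and every $t_0\ge0$ with $\cos\theta_i(t_0)\ge-\frac1{\sqrt2}$, one has $\cos\theta_i(t)\ge-\frac1{\sqrt2}$ for all $t\ge t_0$ and $\cos\theta_i(t)\ge\frac1{\sqrt2}$ for all $t\ge t_0+\frac{(2+\varepsilon)\pi}{\kappa-(2+\varepsilon)\|\Omega\|_\infty}$, is at least $1-\exp\left(-\frac{\varepsilon^2N}{25}\right)$. If in addition $\kappa>\left(\frac{\pi e}{2}\right)^{3/2}\|\Omega\|_\infty$, then \[ m\Big\{(\theta_i^0)\in[-\pi,\pi]^N:\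 \sup_{t\ge0}\theta_i(t)-\inf_{t\ge0}\theta_i(t)<2\pi\ \text{for all } i\Big\}\ge1-\left(\sqrt{\frac{\pi e}{2}}\,\frac{\|\Omega\|_\infty^{1/3}}{\kappa^{1/3}}\right)^N. \] *)

theory Defs
  imports "HOL-Analysis.Analysis"
begin

definition Omega_inf :: "real^'n \<Rightarrow> real" where
  "Omega_inf \<omega> = Max (range (\<lambda>i. \<bar>\<omega> $ i\<bar>))"

definition kura_rhs :: "real \<Rightarrow> real^'n \<Rightarrow> real^'n \<Rightarrow> real^'n" where
  "kura_rhs \<kappa> \<omega> x = (\<chi> i. \<omega> $ i
      - (\<kappa> / real CARD('n)) * (\<Sum>j\<in>UNIV. 1 + cos (x $ j)) * sin (x $ i))"

definition is_solution :: "real \<Rightarrow> real^'n \<Rightarrow> real^'n \<Rightarrow> (real \<Rightarrow> real^'n) \<Rightarrow> bool" where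
  "is_solution \<kappa> \<omega> \<theta>0 \<theta> \<longleftrightarrow> \<theta> 0 = \<theta>0 \<and>
     (\<forall>t\<ge>0. (\<theta> has_vector_derivative kura_rhs \<kappa> \<omega> (\<theta> t)) (at t within {0..}))"

definition order_R :: "(real \<Rightarrow> real^'n) \<Rightarrow> real \<Rightarrow> real" where
  "order_R \<theta> t = (1 / real CARD('n)) * (\<Sum>j\<in>UNIV. 1 + cos (\<theta> t $ j))"

definition cube :: "(real^'n) set" where
  "cube = {x. \<forall>i. x $ i \<in> {-pi..pi}}"

definition norm_meas :: "(real^'n) set \<Rightarrow> real" where
  "norm_meas S = measure lebesgue S / (2 * pi) ^ CARD('n)"

definition osc_bounded :: "(real \<Rightarrow> real^'n) \<Rightarrow> 'n \<Rightarrow> bool" where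
  "osc_bounded \<theta> i \<longleftrightarrow>
     bdd_above ((\<lambda>t. \<theta> t $ i) ` {0..}) \<and> bdd_below ((\<lambda>t. \<theta> t $ i) ` {0..}) \<and>
     (SUP t\<in>{0..}. \<theta> t $ i) - (INF t\<in>{0..}. \<theta> t $ i) < 2 * pi"

end

theory Submission
  imports Defs "HOL-Probability.Distributions" "HOL-Probability.Hoeffding"
begin

text \<open>
  Suppose the order parameter stays above a level \<open>r\<close> with \<open>\<kappa> * r * sin \<alpha> > Omega_inf \<omega>\<close>. Then each
  phase is pushed towards the nearest multiple of \<open>2 * pi\<close> whenever it is outside the
  \<open>\<alpha>\<close>-neighbourhoods of the multiples of \<open>pi\<close>. Hence an oscillator not initially within \<open>\<alpha>\<close> of \<open>pi\<close>
  keeps \<open>1 + cos\<close> above the smaller of its initial value and \<open>1 + cos \<alpha>\<close>, and if the average of these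
  guaranteed amounts exceeds \<open>r\<close>, a continuity argument shows that the order parameter never falls
  to \<open>r\<close>. The bound on oscillations and the trapping property follow from the same barriers.

  The guaranteed amounts are functions of the independent initial phases. For the first claim,
  with \<open>\<alpha> = pi/4\<close>, their average concentrates by Hoeffding's inequality. For the second, with
  \<open>cos \<alpha> = 1 - q\<^sup>2\<close>, \<open>r = q\<^sup>2\<close> and \<open>q\<^sup>3 = Omega_inf \<omega> / \<kappa>\<close>, the exceptional initial data have order
  parameter at most \<open>2 * q\<^sup>2\<close>, and a Chernoff bound with a Gaussian integral estimates their measure.

  Measurability holds because limits of solutions are solutions (Gronwall), so closed conditions on
  solutions cut out closed sets of initial data.
\<close>

subsection \<open>Barriers for a single phase\<close>

lemma last_crossing:
  fixes f :: "real \<Rightarrow> real"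
  assumes cont: "continuous_on {a..b} f" and "a \<le> b" and ends: "f a \<le> c" "c < f b"
  obtains s where "a \<le> s" "s < b" "f s = c" "\<And>t. s < t \<Longrightarrow> t \<le> b \<Longrightarrow> c < f t"
proof -
  let ?low = "{a..b} \<inter> f -` {..c}"
  have "compact ?low"
    using continuous_closed_preimage[OF cont, of "{..c}"]
    by (simp add: compact_eq_bounded_closed bounded_Int)
  moreover have "?low \<noteq> {}" using \<open>a \<le> b\<close> ends(1) by auto
  ultimately obtain s where s: "s \<in> ?low" and last: "\<And>t. t \<in> ?low \<Longrightarrow> t \<le> s"
    using compact_attains_sup by meson
  have "continuous_on {s..b} f"
    using s by (intro continuous_on_subset[OF cont]) auto
  then obtain u where u: "s \<le> u" "u \<le> b" "f u = c"
    using IVT'[of f s c b] s ends(2) by auto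
  then have "u = s" using last[of u] s by auto
  moreover have "c < f t" if "s < t" "t \<le> b" for t
    using last[of t] that s by force
  ultimately show thesis
    using that[of s] s u ends(2) by (auto simp: less_le)
qed

lemma first_crossing:
  fixes f :: "real \<Rightarrow> real"
  assumes cont: "continuous_on {a..b} f" and "a \<le> b" "c < f a" "f b \<le> c"
  obtains s where "a < s" "s \<le> b" "f s = c" "\<And>t. a \<le> t \<Longrightarrow> t < s \<Longrightarrow> c < f t"
proof -
  have "continuous_on {- b..- a} (\<lambda>t. f (- t))"
    by (intro continuous_on_compose2[OF cont] continuous_intros) auto
  then obtain s where "- b \<le> s" "s < - a" "f (- s) = c"
      "\<And>t. s < t \<Longrightarrow> t \<le> - a \<Longrightarrow> c < f (- t)"
    using last_crossing[of "- b" "- a" "\<lambda>t. f (- t)" c] assms by auto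
  then show thesis
    using that[of "- s"] by (metis minus_less_iff minus_le_iff neg_le_iff_le add.inverse_inverse)
qed

lemma barrier_above:
  fixes y y' :: "real \<Rightarrow> real"
  assumes deriv: "\<And>t. t \<in> {a..b} \<Longrightarrow> (y has_real_derivative y' t) (at t within {a..b})"
    and inward: "\<And>t. t \<in> {a..b} \<Longrightarrow> y t = c \<Longrightarrow> y' t < 0"
    and start: "y a \<le> c" and "a \<le> b"
  shows "y b \<le> c"
proof (rule ccontr)
  assume "\<not> y b \<le> c"
  moreover have "continuous_on {a..b} y"
    using deriv by (meson DERIV_continuous_on)
  ultimately obtain s where s: "a \<le> s" "s < b" "y s = c"
      and above: "\<And>t. s < t \<Longrightarrow> t \<le> b \<Longrightarrow> c < y t"
    using last_crossing[of a b y c] start \<open>a \<le> b\<close> by auto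
  then have "y' s < 0" using inward by auto
  then obtain d where d: "d > 0" "\<And>h. h > 0 \<Longrightarrow> s + h \<in> {a..b} \<Longrightarrow> h < d \<Longrightarrow> y (s + h) < y s"
    using has_real_derivative_neg_dec_right[OF deriv, of s] s by auto
  define h where "h = min (d/2) (b - s)"
  have "h > 0" "h < d" "s + h \<in> {a..b}" "s < s + h" "s + h \<le> b"
    using d(1) s by (auto simp: h_def)
  with d(2)[of h] above[of "s + h"] \<open>y s = c\<close> show False by auto
qed

lemma bootstrap_lower_bound:
  fixes R :: "real \<Rightarrow> real"
  assumes cont: "continuous_on {0..} R" and start: "c < R 0"
    and improve: "\<And>T. T \<ge> 0 \<Longrightarrow> (\<And>t. t \<in> {0..T} \<Longrightarrow> c \<le> R t) \<Longrightarrow> c < R T"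
    and "t \<ge> 0"
  shows "c < R t"
proof (rule ccontr)
  assume "\<not> c < R t"
  moreover have "continuous_on {0..t} R" by (rule continuous_on_subset[OF cont]) auto
  ultimately obtain T where T: "0 < T" "R T = c" and before: "\<And>s. 0 \<le> s \<Longrightarrow> s < T \<Longrightarrow> c < R s"
    using first_crossing[of 0 t R c] start \<open>t \<ge> 0\<close> by auto
  have "c \<le> R s" if "s \<in> {0..T}" for s
    using that T before[of s] by (cases "s = T") auto
  then have "c < R T" using T by (intro improve) auto
  then show False using T by simp
qed

lemma sin_le_sin_between:
  assumes "0 \<le> \<alpha>" "\<alpha> \<le> x" "x \<le> pi - \<alpha>"
  shows "sin \<alpha> \<le> sin x"
proof (cases "x \<le> pi/2")
  case True
  then show ?thesis using assms by (intro sin_monotone_2pi_le) auto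
next
  case False
  then have "sin \<alpha> \<le> sin (pi - x)" using assms by (intro sin_monotone_2pi_le) auto
  then show ?thesis by simp
qed

lemma cos_ge_iff_abs_le:
  fixes z \<beta> :: real
  assumes "\<bar>z\<bar> \<le> pi" "0 \<le> \<beta>" "\<beta> \<le> pi"
  shows "cos \<beta> \<le> cos z \<longleftrightarrow> \<bar>z\<bar> \<le> \<beta>"
  using cos_mono_le_eq[of \<beta> "\<bar>z\<bar>"] assms by simp

lemma shift_into_period:
  fixes z :: real
  obtains n :: int where "\<bar>z + 2 * pi * of_int n\<bar> \<le> pi"
proof -
  define n where "n = - \<lfloor>(z + pi) / (2 * pi)\<rfloor>"
  have "of_int (- n) \<le> (z + pi) / (2 * pi)" "(z + pi) / (2 * pi) < of_int (- n) + 1"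
    by (simp_all add: n_def)
  then have "\<bar>z + 2 * pi * of_int n\<bar> \<le> pi"
    by (simp add: field_simps abs_le_iff)
  then show thesis using that by blast
qed

locale driven_phase =
  fixes J :: "real set" and y K :: "real \<Rightarrow> real" and w k \<alpha> :: real
  assumes interval: "is_interval J"
    and alpha: "0 < \<alpha>" "\<alpha> < pi/2"
    and phase_deriv: "\<And>t. t \<in> J \<Longrightarrow> (y has_real_derivative w - K t * sin (y t)) (at t within J)"
    and coupling: "\<And>t. t \<in> J \<Longrightarrow> k \<le> K t"
    and strong: "\<bar>w\<bar> < k * sin \<alpha>"
begin

lemma sin_alpha_pos: "0 < sin \<alpha>"
  using alpha by (intro sin_gt_zero) auto

lemma coupling_pos: "0 < k"
  using strong sin_alpha_pos by (smt (verit) zero_less_mult_pos2)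

lemma Icc_subset: "s \<in> J \<Longrightarrow> t \<in> J \<Longrightarrow> {s..t} \<subseteq> J"
  using interval unfolding is_interval_1 by (meson atLeastAtMost_iff subsetI)

lemma phase_deriv_Icc:
  "s \<in> J \<Longrightarrow> t \<in> J \<Longrightarrow> u \<in> {s..t} \<Longrightarrow>
    (y has_real_derivative w - K u * sin (y u)) (at u within {s..t})"
  by (rule DERIV_subset[OF phase_deriv]) (use Icc_subset in blast)+

lemma velocity_le:
  assumes "t \<in> J" "sin \<alpha> \<le> sin (y t)"
  shows "w - K t * sin (y t) \<le> - (k * sin \<alpha> - \<bar>w\<bar>)"
proof -
  have "k * sin \<alpha> \<le> K t * sin (y t)"
    using assms coupling[of t] coupling_pos sin_alpha_pos by (intro mult_mono) auto
  then show ?thesis by simp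
qed

lemma stays_below:
  assumes "s \<in> J" "t \<in> J" "s \<le> t" "sin \<alpha> \<le> sin c" "y s \<le> c"
  shows "y t \<le> c"
proof (rule barrier_above[where y = y and a = s])
  show "(y has_real_derivative w - K u * sin (y u)) (at u within {s..t})" if "u \<in> {s..t}" for u
    using phase_deriv_Icc assms that by blast
  show "w - K u * sin (y u) < 0" if "u \<in> {s..t}" "y u = c" for u
    using velocity_le[of u] that assms Icc_subset[of s t] strong by auto
qed (use assms in auto)

lemma driven_phase_uminus: "driven_phase J (\<lambda>t. - y t) K (- w) k \<alpha>"
proof
  fix t assume "t \<in> J"
  then show "((\<lambda>t. - y t) has_real_derivative - w - K t * sin (- y t)) (at t within J)"
    using DERIV_minus[OF phase_deriv] by simp
qed (use interval alpha coupling strong in auto)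

lemma driven_phase_shift: "driven_phase J (\<lambda>t. y t + 2 * pi * of_int n) K w k \<alpha>"
proof
  fix t assume "t \<in> J"
  moreover have "sin (y t + 2 * pi * of_int n) = sin (y t)"
    by (simp add: sin_add sin_int_2pin cos_int_2pin)
  ultimately show "((\<lambda>t. y t + 2 * pi * of_int n) has_real_derivative
      w - K t * sin (y t + 2 * pi * of_int n)) (at t within J)"
    by (auto intro!: derivative_eq_intros phase_deriv)
qed (use interval alpha coupling strong in auto)

lemma stays_above:
  assumes "s \<in> J" "t \<in> J" "s \<le> t" "sin c \<le> - sin \<alpha>" "c \<le> y s"
  shows "c \<le> y t"
  using driven_phase.stays_below[OF driven_phase_uminus, of s t "-c"] assms by simp

lemma abs_le_max:
  assumes "s \<in> J" "t \<in> J" "s \<le> t" "\<bar>y s\<bar> \<le> pi - \<alpha>"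
  shows "\<bar>y t\<bar> \<le> max \<bar>y s\<bar> \<alpha>"
proof -
  have "sin \<alpha> \<le> sin (max \<bar>y s\<bar> \<alpha>)"
    using assms alpha by (intro sin_le_sin_between) auto
  then have "y t \<le> max \<bar>y s\<bar> \<alpha>" "- max \<bar>y s\<bar> \<alpha> \<le> y t"
    using assms by (auto intro!: stays_below[of s t] stays_above[of s t])
  then show ?thesis by (simp add: abs_le_iff minus_le_iff)
qed

lemma le_alpha_after:
  assumes "s \<in> J" "t \<in> J" "s \<le> t" "y s \<le> pi - \<alpha>"
    and late: "pi - 2 * \<alpha> \<le> (k * sin \<alpha> - \<bar>w\<bar>) * (t - s)"
  shows "y t \<le> \<alpha>"
proof (rule ccontr)
  assume "\<not> y t \<le> \<alpha>"
  then have "\<alpha> < y t" by simp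
  have "s < t" using late alpha assms(3) by (cases "s = t") auto
  have between: "\<alpha> \<le> y u \<and> y u \<le> pi - \<alpha>" if "u \<in> {s..t}" for u
  proof -
    have "u \<in> J" using that Icc_subset assms(1,2) by blast
    then show ?thesis
      using stays_below[of u t \<alpha>] stays_below[of s u "pi - \<alpha>"] that \<open>\<alpha> < y t\<close> assms by force
  qed
  obtain u where u: "u \<in> {s<..<t}" "y t - y s = (w - K u * sin (y u)) * (t - s)"
    using mvt_simple[OF \<open>s < t\<close>, of y "\<lambda>u. (*) (w - K u * sin (y u))"]
      phase_deriv_Icc[OF assms(1,2)]
    unfolding has_field_derivative_def by auto
  have "w - K u * sin (y u) \<le> - (k * sin \<alpha> - \<bar>w\<bar>)"
    using between[of u] u Icc_subset[OF assms(1,2)] alpha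
    by (intro velocity_le sin_le_sin_between) auto
  then have "y t - y s \<le> - (k * sin \<alpha> - \<bar>w\<bar>) * (t - s)"
    unfolding u(2) using \<open>s < t\<close> by (intro mult_right_mono) auto
  then show False using late \<open>\<alpha> < y t\<close> assms by (simp add: algebra_simps)
qed

lemma abs_le_alpha_after:
  assumes "s \<in> J" "t \<in> J" "s \<le> t" "\<bar>y s\<bar> \<le> pi - \<alpha>"
    and late: "pi - 2 * \<alpha> \<le> (k * sin \<alpha> - \<bar>w\<bar>) * (t - s)"
  shows "\<bar>y t\<bar> \<le> \<alpha>"
  using le_alpha_after[of s t] driven_phase.le_alpha_after[OF driven_phase_uminus, of s t] assms
  by (auto simp: abs_le_iff)

lemma cos_trapped:
  assumes "s \<in> J" "t \<in> J" "s \<le> t" and start: "cos (pi - \<alpha>) \<le> cos (y s)"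
  shows "cos (pi - \<alpha>) \<le> cos (y t)"
    and "pi - 2 * \<alpha> \<le> (k * sin \<alpha> - \<bar>w\<bar>) * (t - s) \<Longrightarrow> cos \<alpha> \<le> cos (y t)"
proof -
  obtain n :: int where n: "\<bar>y s + 2 * pi * of_int n\<bar> \<le> pi" using shift_into_period .
  define z where "z = (\<lambda>t. y t + 2 * pi * of_int n)"
  interpret z: driven_phase J z K w k \<alpha>
    unfolding z_def by (rule driven_phase_shift)
  have cos_z: "cos (z u) = cos (y u)" for u
    by (simp add: z_def cos_add sin_int_2pin cos_int_2pin)
  have z_start: "\<bar>z s\<bar> \<le> pi - \<alpha>"
    using cos_ge_iff_abs_le[of "z s" "pi - \<alpha>"] n start alpha cos_z[of s] by (simp add: z_def)
  then have z_end: "\<bar>z t\<bar> \<le> pi - \<alpha>"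
    using z.abs_le_max[OF assms(1-3)] alpha by auto
  then show "cos (pi - \<alpha>) \<le> cos (y t)"
    using cos_ge_iff_abs_le[of "z t" "pi - \<alpha>"] alpha cos_z[of t] by simp
  assume "pi - 2 * \<alpha> \<le> (k * sin \<alpha> - \<bar>w\<bar>) * (t - s)"
  then have "\<bar>z t\<bar> \<le> \<alpha>" by (intro z.abs_le_alpha_after[OF assms(1-3) z_start])
  then show "cos \<alpha> \<le> cos (y t)"
    using cos_ge_iff_abs_le[of "z t" \<alpha>] z_end alpha cos_z[of t] by simp
qed

text \<open>A phase that starts within \<open>\<alpha>\<close> of \<open>pi\<close> either drops below \<open>pi - \<alpha>\<close> and then never
  climbs to \<open>pi + \<alpha>\<close> again, or vice versa; so only one of the two adjacent wells is visited.\<close>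

lemma oscillation_near_pi:
  assumes "s0 \<in> J" "\<And>t. t \<in> J \<Longrightarrow> s0 \<le> t" "pi - \<alpha> \<le> y s0" "y s0 \<le> pi + \<alpha>" "s \<in> J" "t \<in> J"
  shows "y s - y t \<le> pi + 2 * \<alpha>"
proof (cases "\<exists>u\<in>J. pi + \<alpha> \<le> y u")
  case True
  then obtain u where u: "u \<in> J" "pi + \<alpha> \<le> y u" by auto
  have "pi - \<alpha> \<le> y t"
  proof (cases "t \<le> u")
    case True
    then show ?thesis
      using stays_below[of t u "pi - \<alpha>"] assms u alpha by force
  next
    case False
    then show ?thesis
      using stays_above[of u t "pi + \<alpha>"] assms u alpha by (force simp: sin_add)
  qed
  moreover have "y s \<le> 2 * pi + \<alpha>"
    using stays_below[of s0 s "2 * pi + \<alpha>"] assms alpha by (force simp: sin_add)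
  ultimately show ?thesis by simp
next
  case False
  then have "y s \<le> pi + \<alpha>" using assms(5) by force
  moreover have "- \<alpha> \<le> y t"
    using stays_above[of s0 t "- \<alpha>"] assms alpha by force
  ultimately show ?thesis by simp
qed

lemma oscillation_le:
  assumes "s0 \<in> J" "\<And>t. t \<in> J \<Longrightarrow> s0 \<le> t" "\<bar>y s0\<bar> \<le> pi" "s \<in> J" "t \<in> J"
  shows "y s - y t \<le> max (2 * pi - 2 * \<alpha>) (pi + 2 * \<alpha>)"
proof -
  consider (inner) "\<bar>y s0\<bar> \<le> pi - \<alpha>" | (near_pi) "pi - \<alpha> \<le> y s0" | (near_minus_pi) "pi - \<alpha> \<le> - y s0"
    by linarith
  then show ?thesis
  proof cases
    case inner
    then have "\<bar>y u\<bar> \<le> pi - \<alpha>" if "u \<in> J" for u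
      using abs_le_max[of s0 u] that assms alpha by auto
    from this[of s] this[of t] show ?thesis using assms by simp
  next
    case near_pi
    then show ?thesis using oscillation_near_pi[of s0 s t] assms alpha by auto
  next
    case near_minus_pi
    then show ?thesis
      using driven_phase.oscillation_near_pi[OF driven_phase_uminus, of s0 t s] assms alpha by auto
  qed
qed

end

subsection \<open>Limits of solutions\<close>

lemma gronwall_differential:
  fixes h h' :: "real \<Rightarrow> real"
  assumes deriv: "\<And>s. 0 \<le> s \<Longrightarrow> s \<le> t \<Longrightarrow> (h has_real_derivative h' s) (at s within {0..t})"
    and growth: "\<And>s. 0 \<le> s \<Longrightarrow> s \<le> t \<Longrightarrow> h' s \<le> K * h s"
    and "0 \<le> t"
  shows "h t \<le> exp (K * t) * h 0"
proof (cases "t = 0")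
  case False
  have "((\<lambda>s. exp (- K * s) * h s) has_real_derivative exp (- K * s) * (h' s - K * h s))
      (at s within {0..t})" if "0 \<le> s" "s \<le> t" for s
    by (rule derivative_eq_intros deriv that refl)+ (simp add: algebra_simps)
  then obtain s where s: "s \<in> {0<..<t}"
      "exp (- K * t) * h t - exp (- K * 0) * h 0 = exp (- K * s) * (h' s - K * h s) * (t - 0)"
    using mvt_simple[of 0 t "\<lambda>s. exp (- K * s) * h s" "\<lambda>s. (*) (exp (- K * s) * (h' s - K * h s))"]
      False \<open>0 \<le> t\<close> unfolding has_field_derivative_def by auto
  have "exp (- K * s) * (h' s - K * h s) * t \<le> 0"
    using growth[of s] s(1) \<open>0 \<le> t\<close> by (intro mult_nonpos_nonneg mult_nonneg_nonpos) auto
  then have "exp (- K * t) * h t \<le> h 0" using s(2) by simp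
  then show ?thesis by (simp add: exp_minus field_simps)
qed simp

lemma dist_solutions_le:
  fixes F :: "'a::real_inner \<Rightarrow> 'a"
  assumes lipschitz: "L-lipschitz_on UNIV F"
    and u: "\<And>t. t \<ge> 0 \<Longrightarrow> (u has_vector_derivative F (u t)) (at t within {0..})"
    and v: "\<And>t. t \<ge> 0 \<Longrightarrow> (v has_vector_derivative F (v t)) (at t within {0..})"
    and "t \<ge> 0"
  shows "dist (u t) (v t) \<le> exp (L * t) * dist (u 0) (v 0)"
proof -
  have "(norm (u t - v t))\<^sup>2 \<le> exp (2 * L * t) * (norm (u 0 - v 0))\<^sup>2"
  proof (rule gronwall_differential)
    fix s assume s: "0 \<le> s" "s \<le> t"
    have "(u has_derivative (\<lambda>z. z *\<^sub>R F (u s))) (at s within {0..t})"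
      "(v has_derivative (\<lambda>z. z *\<^sub>R F (v s))) (at s within {0..t})"
      using u[THEN has_vector_derivative_within_subset, of s "{0..t}"]
        v[THEN has_vector_derivative_within_subset, of s "{0..t}"] s
      by (auto simp: has_vector_derivative_def)
    then show "((\<lambda>s. (norm (u s - v s))\<^sup>2) has_real_derivative
        2 * ((u s - v s) \<bullet> (F (u s) - F (v s)))) (at s within {0..t})"
      unfolding has_field_derivative_def power2_norm_eq_inner
      by (auto intro!: derivative_eq_intros simp: algebra_simps inner_diff inner_commute)
    have "(u s - v s) \<bullet> (F (u s) - F (v s)) \<le> norm (u s - v s) * norm (F (u s) - F (v s))"
      by (rule norm_cauchy_schwarz)
    also have "\<dots> \<le> norm (u s - v s) * (L * norm (u s - v s))"
      using lipschitz by (intro mult_left_mono lipschitz_on_normD) auto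
    finally show "2 * ((u s - v s) \<bullet> (F (u s) - F (v s))) \<le> 2 * L * (norm (u s - v s))\<^sup>2"
      by (simp add: power2_eq_square mult_ac)
  qed fact
  also have "\<dots> = (exp (L * t) * norm (u 0 - v 0))\<^sup>2"
    using exp_double[of "L * t"] by (simp add: power_mult_distrib mult.assoc)
  finally show ?thesis
    unfolding dist_norm by (rule power2_le_imp_le) simp
qed

lemma has_vector_derivative_uniform_limit:
  fixes u :: "nat \<Rightarrow> real \<Rightarrow> 'a::banach"
  assumes deriv: "\<And>n t. t \<in> S \<Longrightarrow> (u n has_vector_derivative u' n t) (at t within S)"
    and "convex S" "t \<in> S"
    and lim: "\<And>t. t \<in> S \<Longrightarrow> (\<lambda>n. u n t) \<longlonglongrightarrow> v t"
    and lim': "uniform_limit S u' v' sequentially"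
  shows "(v has_vector_derivative v' t) (at t within S)"
proof -
  have "\<exists>g. \<forall>s\<in>S. (\<lambda>n. u n s) \<longlonglongrightarrow> g s \<and> (g has_derivative (\<lambda>h. h *\<^sub>R v' s)) (at s within S)"
  proof (rule has_derivative_sequence[where f' = "\<lambda>n s h. h *\<^sub>R u' n s"])
    show "(u n has_derivative (\<lambda>h. h *\<^sub>R u' n s)) (at s within S)" if "s \<in> S" for n s
      using deriv[OF that] by (simp add: has_vector_derivative_def)
    show "\<forall>\<^sub>F n in sequentially. \<forall>s\<in>S. \<forall>h. norm (h *\<^sub>R u' n s - h *\<^sub>R v' s) \<le> e * norm h"
      if "e > 0" for e
      using uniform_limitD[OF lim' that]
    proof eventually_elim
      case (elim n)
      have "\<bar>h\<bar> * norm (u' n s - v' s) \<le> \<bar>h\<bar> * e" if "s \<in> S" for s h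
        using elim that by (intro mult_left_mono) (auto simp: dist_norm less_imp_le)
      then show ?case
        by (simp add: mult.commute flip: scaleR_diff_right)
    qed
  qed (use assms in auto)
  then obtain g where g: "\<And>s. s \<in> S \<Longrightarrow> (\<lambda>n. u n s) \<longlonglongrightarrow> g s"
      "\<And>s. s \<in> S \<Longrightarrow> (g has_vector_derivative v' s) (at s within S)"
    unfolding has_vector_derivative_def by blast
  have "g s = v s" if "s \<in> S" for s
    using LIMSEQ_unique[OF g(1) lim] that by blast
  then show ?thesis
    using g(2) \<open>t \<in> S\<close> by (intro has_vector_derivative_transform[OF _ _ g(2)]) auto
qed

lemma uniformly_Cauchy_on_solutions:
  fixes F :: "'a::real_inner \<Rightarrow> 'a"
  assumes lipschitz: "L-lipschitz_on UNIV F"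
    and u: "\<And>n t. t \<ge> 0 \<Longrightarrow> (u n has_vector_derivative F (u n t)) (at t within {0..})"
    and "Cauchy (\<lambda>n. u n 0)"
  shows "uniformly_Cauchy_on {0..T} u"
proof (rule uniformly_Cauchy_onI)
  fix e :: real assume "e > 0"
  then have "e / exp (L * T) > 0" by simp
  then obtain M where M: "dist (u m 0) (u n 0) < e / exp (L * T)" if "m \<ge> M" "n \<ge> M" for m n
    using metric_CauchyD[OF \<open>Cauchy _\<close>] by blast
  have "dist (u m t) (u n t) < e" if "t \<in> {0..T}" "m \<ge> M" "n \<ge> M" for m n t
  proof -
    have "dist (u m t) (u n t) \<le> exp (L * t) * dist (u m 0) (u n 0)"
      using that by (intro dist_solutions_le[OF lipschitz u u]) auto
    also have "\<dots> \<le> exp (L * T) * dist (u m 0) (u n 0)"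
      using that lipschitz_on_nonneg[OF lipschitz]
      by (intro mult_right_mono) (auto intro: mult_left_mono)
    also have "\<dots> < e"
      using M[OF that(2,3)] by (simp add: field_simps)
    finally show ?thesis .
  qed
  then show "\<exists>M. \<forall>t\<in>{0..T}. \<forall>m\<ge>M. \<forall>n\<ge>M. dist (u m t) (u n t) < e" by blast
qed

lemma limit_of_solutions:
  fixes F :: "'a::{real_inner, banach} \<Rightarrow> 'a"
  assumes lipschitz: "L-lipschitz_on UNIV F"
    and u: "\<And>n t. t \<ge> 0 \<Longrightarrow> (u n has_vector_derivative F (u n t)) (at t within {0..})"
    and "Cauchy (\<lambda>n. u n 0)"
  obtains v where "\<And>t. t \<ge> 0 \<Longrightarrow> (\<lambda>n. u n t) \<longlonglongrightarrow> v t"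
    and "\<And>t. t \<ge> 0 \<Longrightarrow> (v has_vector_derivative F (v t)) (at t within {0..})"
proof
  define v where "v t = lim (\<lambda>n. u n t)" for t
  have "uniformly_convergent_on {0..T} u" for T
    unfolding uniformly_convergent_eq_Cauchy
    by (rule uniformly_Cauchy_on_solutions[OF lipschitz u assms(3)])
  then have uniform: "uniform_limit {0..T} u v sequentially" for T
    by (simp add: uniformly_convergent_uniform_limit_iff v_def[abs_def])
  show lim: "(\<lambda>n. u n t) \<longlonglongrightarrow> v t" if "t \<ge> 0" for t
    using tendsto_uniform_limitI[OF uniform[of t]] that by simp
  show "(v has_vector_derivative F (v t)) (at t within {0..})" if "t \<ge> 0" for t
  proof -
    have "(v has_vector_derivative F (v t)) (at t within {0..t + 1})"
    proof (rule has_vector_derivative_uniform_limit)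
      show "(u n has_vector_derivative F (u n s)) (at s within {0..t + 1})"
        if "s \<in> {0..t + 1}" for n s
        by (rule has_vector_derivative_within_subset[OF u]) (use that in auto)
      show "uniform_limit {0..t + 1} (\<lambda>n s. F (u n s)) (\<lambda>s. F (v s)) sequentially"
        using uniform_limit_compose[OF uniform lipschitz_on_uniformly_continuous[OF lipschitz]]
        by (simp add: o_def)
    qed (use lim that in auto)
    moreover have "at t within {0..t + 1} = at t within {0..}"
      by (rule at_within_nhd[where S = "{..<t + 1}"]) auto
    ultimately show ?thesis by simp
  qed
qed

lemma lipschitz_on_sum:
  fixes f :: "'i \<Rightarrow> 'a::metric_space \<Rightarrow> 'b::real_normed_vector"
  assumes "\<And>i. i \<in> I \<Longrightarrow> (C i)-lipschitz_on U (f i)"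
  shows "(\<Sum>i\<in>I. C i)-lipschitz_on U (\<lambda>x. \<Sum>i\<in>I. f i x)"
  using assms by (induction I rule: infinite_finite_induct) (auto intro: lipschitz_intros)

lemma lipschitz_on_mult_bounded:
  fixes f g :: "'a::metric_space \<Rightarrow> 'b::real_normed_algebra"
  assumes f: "C-lipschitz_on U f" "\<And>x. x \<in> U \<Longrightarrow> norm (f x) \<le> A"
    and g: "D-lipschitz_on U g" "\<And>x. x \<in> U \<Longrightarrow> norm (g x) \<le> B"
    and nonneg: "0 \<le> A" "0 \<le> B"
  shows "(A * D + C * B)-lipschitz_on U (\<lambda>x. f x * g x)"
proof (rule lipschitz_onI)
  fix x y assume xy: "x \<in> U" "y \<in> U"
  have "norm (f x * g x - f y * g y) = norm (f x * (g x - g y) + (f x - f y) * g y)"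
    by (simp add: algebra_simps)
  also have "\<dots> \<le> norm (f x) * norm (g x - g y) + norm (f x - f y) * norm (g y)"
    by (intro order_trans[OF norm_triangle_ineq] add_mono norm_mult_ineq)
  also have "\<dots> \<le> A * (D * dist x y) + (C * dist x y) * B"
    using lipschitz_onD[OF f(1) xy] lipschitz_onD[OF g(1) xy] lipschitz_on_nonneg[OF f(1)] f g xy nonneg
    by (intro add_mono mult_mono) (auto simp: dist_norm)
  finally show "dist (f x * g x) (f y * g y) \<le> (A * D + C * B) * dist x y"
    by (simp add: dist_norm algebra_simps)
qed (use nonneg lipschitz_on_nonneg[OF f(1)] lipschitz_on_nonneg[OF g(1)] in simp)

lemma lipschitz_on_vec_nth: "1-lipschitz_on U (\<lambda>x::'a::metric_space^'n. x $ i)"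
  by (rule lipschitz_onI) (simp_all add: dist_vec_nth_le)

lemma lipschitz_on_vec:
  fixes f :: "'a::metric_space \<Rightarrow> real^'n"
  assumes "\<And>i. C-lipschitz_on U (\<lambda>x. f x $ i)"
  shows "(real CARD('n) * C)-lipschitz_on U f"
proof (rule lipschitz_onI)
  fix x y assume "x \<in> U" "y \<in> U"
  have "dist (f x) (f y) \<le> (\<Sum>i\<in>UNIV. \<bar>(f x - f y) $ i\<bar>)"
    unfolding dist_norm by (rule norm_le_l1_cart)
  also have "\<dots> \<le> (\<Sum>i\<in>(UNIV::'n set). C * dist x y)"
    using lipschitz_onD[OF assms \<open>x \<in> U\<close> \<open>y \<in> U\<close>] by (intro sum_mono) (simp add: dist_real_def)
  finally show "dist (f x) (f y) \<le> real CARD('n) * C * dist x y" by simp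
qed (use lipschitz_on_nonneg[OF assms] in simp)

lemma lipschitz_on_sin: "1-lipschitz_on U (sin :: real \<Rightarrow> real)"
  and lipschitz_on_cos: "1-lipschitz_on U (cos :: real \<Rightarrow> real)"
proof -
  have "1-lipschitz_on UNIV (sin :: real \<Rightarrow> real)" "1-lipschitz_on UNIV (cos :: real \<Rightarrow> real)"
    by (rule bounded_derivative_imp_lipschitz, rule has_derivative_sin has_derivative_cos,
        rule has_derivative_ident, auto intro!: onorm_bound simp: abs_mult mult_left_le)+
  then show "1-lipschitz_on U (sin :: real \<Rightarrow> real)" "1-lipschitz_on U (cos :: real \<Rightarrow> real)"
    by (auto elim: lipschitz_on_subset)
qed

lemma kura_rhs_lipschitz:
  obtains L where "L-lipschitz_on UNIV (kura_rhs \<kappa> \<omega> :: real^'n \<Rightarrow> real^'n)"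
proof -
  let ?N = "real CARD('n)"
  define S where "S x = (\<Sum>j\<in>UNIV. 1 + cos (x $ j))" for x :: "real^'n"
  have nth: "1-lipschitz_on U (\<lambda>x. g (x $ i))" if "\<And>U. 1-lipschitz_on U g"
    for g :: "real \<Rightarrow> real" and U and i :: 'n
    using lipschitz_on_compose2[OF lipschitz_on_vec_nth that] by simp
  have "(\<Sum>j\<in>(UNIV::'n set). 0 + 1)-lipschitz_on UNIV S"
    unfolding S_def[abs_def]
    by (intro lipschitz_on_sum lipschitz_on_add lipschitz_on_constant nth lipschitz_on_cos)
  moreover have "\<bar>S x\<bar> \<le> (\<Sum>j\<in>(UNIV::'n set). 2)" for x
    unfolding S_def
    by (intro order_trans[OF sum_abs sum_mono]) (smt (verit) cos_le_one cos_ge_minus_one)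
  ultimately have product: "(2 * ?N * 1 + ?N * 1)-lipschitz_on UNIV (\<lambda>x. S x * sin (x $ i))" for i
    by (intro lipschitz_on_mult_bounded nth lipschitz_on_sin) (auto simp: mult.commute)
  have kura: "kura_rhs \<kappa> \<omega> x $ i = \<omega> $ i - \<kappa> / ?N * (S x * sin (x $ i))" for x i
    by (simp add: kura_rhs_def S_def)
  have "(0 + \<bar>\<kappa> / ?N\<bar> * (2 * ?N * 1 + ?N * 1))-lipschitz_on UNIV (\<lambda>x. kura_rhs \<kappa> \<omega> x $ i)" for i
    unfolding kura by (intro lipschitz_on_diff lipschitz_on_constant lipschitz_on_cmult_real product)
  from lipschitz_on_vec[OF this] that show thesis by blast
qed

lemma is_solution_unique:
  assumes "is_solution \<kappa> \<omega> x \<theta>" "is_solution \<kappa> \<omega> x \<eta>" "t \<ge> 0"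
  shows "\<theta> t = \<eta> t"
proof -
  obtain L where "L-lipschitz_on UNIV (kura_rhs \<kappa> \<omega>)" by (rule kura_rhs_lipschitz)
  from dist_solutions_le[OF this, of \<theta> \<eta> t] assms show ?thesis by (simp add: is_solution_def)
qed

lemma is_solution_limit:
  fixes \<omega> :: "real^'n"
  assumes sol: "\<And>n. is_solution \<kappa> \<omega> (X n) (\<Theta> n)" and "X \<longlonglongrightarrow> x"
  obtains \<theta> where "is_solution \<kappa> \<omega> x \<theta>" "\<And>t. t \<ge> 0 \<Longrightarrow> (\<lambda>n. \<Theta> n t) \<longlonglongrightarrow> \<theta> t"
proof -
  obtain L where L: "L-lipschitz_on UNIV (kura_rhs \<kappa> \<omega>)" by (rule kura_rhs_lipschitz)
  have start: "(\<lambda>n. \<Theta> n 0) \<longlonglongrightarrow> x"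
    using assms by (simp add: is_solution_def)
  have "(\<Theta> n has_vector_derivative kura_rhs \<kappa> \<omega> (\<Theta> n t)) (at t within {0..})" if "t \<ge> 0" for n t
    using sol that by (simp add: is_solution_def)
  then obtain \<theta> where lim: "\<And>t. t \<ge> 0 \<Longrightarrow> (\<lambda>n. \<Theta> n t) \<longlonglongrightarrow> \<theta> t"
      and deriv: "\<And>t. t \<ge> 0 \<Longrightarrow> (\<theta> has_vector_derivative kura_rhs \<kappa> \<omega> (\<theta> t)) (at t within {0..})"
    using limit_of_solutions[OF L, of \<Theta>] LIMSEQ_imp_Cauchy[OF start] by blast
  have "\<theta> 0 = x"
    using LIMSEQ_unique[OF lim start] by simp
  then show thesis
    using that[of \<theta>] lim deriv by (simp add: is_solution_def)
qed

subsection \<open>Measurability of sets of initial data\<close>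

definition initial_data :: "real \<Rightarrow> real^'n \<Rightarrow> ((real \<Rightarrow> real^'n) \<Rightarrow> bool) \<Rightarrow> (real^'n) set" where
  "initial_data \<kappa> \<omega> P = {x \<in> cube. \<forall>\<theta>. is_solution \<kappa> \<omega> x \<theta> \<longrightarrow> P \<theta>}"

definition coherent :: "real \<Rightarrow> (real \<Rightarrow> real^'n) \<Rightarrow> bool" where
  "coherent r \<theta> \<longleftrightarrow> (\<forall>t\<ge>0. r \<le> order_R \<theta> t)"

definition osc_at_most :: "real \<Rightarrow> (real \<Rightarrow> real^'n) \<Rightarrow> 'n \<Rightarrow> bool" where
  "osc_at_most M \<theta> i \<longleftrightarrow> (\<forall>s\<ge>0. \<forall>t\<ge>0. \<theta> s $ i - \<theta> t $ i \<le> M)"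

definition closed_under_limits :: "((real \<Rightarrow> 'a::topological_space) \<Rightarrow> bool) \<Rightarrow> bool" where
  "closed_under_limits P \<longleftrightarrow>
    (\<forall>\<Theta> \<theta>. (\<forall>n::nat. P (\<Theta> n)) \<longrightarrow> (\<forall>t\<ge>0. (\<lambda>n. \<Theta> n t) \<longlonglongrightarrow> \<theta> t) \<longrightarrow> P \<theta>)"

lemma closed_under_limits_solution_unique:
  assumes "closed_under_limits P" "is_solution \<kappa> \<omega> x \<theta>" "is_solution \<kappa> \<omega> x \<eta>" "P \<theta>"
  shows "P \<eta>"
proof -
  have "\<forall>t\<ge>0. (\<lambda>n::nat. \<theta> t) \<longlonglongrightarrow> \<eta> t"
    using is_solution_unique[OF assms(2,3)] by simp
  then show ?thesis
    using assms(1,4) unfolding closed_under_limits_def by (auto dest!: spec[of _ "\<lambda>n. \<theta>"])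
qed

lemma closed_under_limits_coherent: "closed_under_limits (coherent r :: (real \<Rightarrow> real^'n) \<Rightarrow> bool)"
  unfolding closed_under_limits_def coherent_def
proof (intro allI impI)
  fix \<Theta> :: "nat \<Rightarrow> real \<Rightarrow> real^'n" and \<theta> and t :: real
  assume large: "\<forall>n. \<forall>t\<ge>0. r \<le> order_R (\<Theta> n) t"
    and lim: "\<forall>t\<ge>0. (\<lambda>n. \<Theta> n t) \<longlonglongrightarrow> \<theta> t" and t: "t \<ge> 0"
  have "(\<lambda>n. order_R (\<Theta> n) t) \<longlonglongrightarrow> order_R \<theta> t"
    unfolding order_R_def using lim t by (intro tendsto_intros) auto
  then show "r \<le> order_R \<theta> t"
    by (rule LIMSEQ_le_const) (use large t in auto)
qed

lemma closed_under_limits_osc_at_most: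
  "closed_under_limits (\<lambda>\<theta> :: real \<Rightarrow> real^'n. osc_at_most M \<theta> i)"
  unfolding closed_under_limits_def osc_at_most_def
proof (intro allI impI)
  fix \<Theta> :: "nat \<Rightarrow> real \<Rightarrow> real^'n" and \<theta> and s t :: real
  assume bound: "\<forall>n. \<forall>s\<ge>0. \<forall>t\<ge>0. \<Theta> n s $ i - \<Theta> n t $ i \<le> M"
    and lim: "\<forall>t\<ge>0. (\<lambda>n. \<Theta> n t) \<longlonglongrightarrow> \<theta> t" and st: "s \<ge> 0" "t \<ge> 0"
  have "(\<lambda>n. \<Theta> n s $ i - \<Theta> n t $ i) \<longlonglongrightarrow> \<theta> s $ i - \<theta> t $ i"
    using lim st by (intro tendsto_intros) auto
  then show "\<theta> s $ i - \<theta> t $ i \<le> M"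
    by (rule LIMSEQ_le_const2) (use bound st in auto)
qed

lemma closed_solvable_initial_data:
  fixes \<omega> :: "real^'n"
  assumes "closed_under_limits P"
  shows "closed {x. \<exists>\<theta>. is_solution \<kappa> \<omega> x \<theta> \<and> P \<theta>}"
  unfolding closed_sequential_limits
proof (intro allI impI, elim conjE)
  fix X x assume "\<forall>n. X n \<in> {x. \<exists>\<theta>. is_solution \<kappa> \<omega> x \<theta> \<and> P \<theta>}" and "X \<longlonglongrightarrow> x"
  then obtain \<Theta> where sol: "\<And>n. is_solution \<kappa> \<omega> (X n) (\<Theta> n)" and P: "\<And>n. P (\<Theta> n)"
    by simp metis
  obtain \<theta> where "is_solution \<kappa> \<omega> x \<theta>" "\<And>t. t \<ge> 0 \<Longrightarrow> (\<lambda>n. \<Theta> n t) \<longlonglongrightarrow> \<theta> t"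
    using is_solution_limit[OF sol \<open>X \<longlonglongrightarrow> x\<close>] by blast
  moreover from this have "P \<theta>"
    using assms P unfolding closed_under_limits_def by blast
  ultimately show "x \<in> {x. \<exists>\<theta>. is_solution \<kappa> \<omega> x \<theta> \<and> P \<theta>}" by blast
qed

lemma cube_eq_cbox: "cube = cbox (\<chi> i. - pi) (\<chi> i. pi)"
  by (auto simp: cube_def mem_box_cart)

lemma cube_in_borel [measurable]: "cube \<in> sets borel"
  by (simp add: cube_eq_cbox)

text \<open>No existence theorem is needed: the initial data without a solution form an open set
  and satisfy the condition vacuously.\<close>

lemma initial_data_in_borel:
  fixes \<omega> :: "real^'n"
  assumes "closed_under_limits P"
  shows "initial_data \<kappa> \<omega> P \<in> sets borel"
proof -
  have "initial_data \<kappa> \<omega> P =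
      cube \<inter> (- {x. \<exists>\<theta>. is_solution \<kappa> \<omega> x \<theta> \<and> True} \<union> {x. \<exists>\<theta>. is_solution \<kappa> \<omega> x \<theta> \<and> P \<theta>})"
    unfolding initial_data_def using closed_under_limits_solution_unique[OF assms] by blast
  also have "\<dots> \<in> sets borel"
    using closed_solvable_initial_data[of "\<lambda>_. True" \<kappa> \<omega>]
      closed_solvable_initial_data[OF assms, of \<kappa> \<omega>]
    by (intro sets.Int sets.Un borel_comp borel_closed cube_in_borel)
      (auto simp: closed_under_limits_def)
  finally show ?thesis .
qed

lemma initial_data_Ex:
  fixes \<omega> :: "real^'n"
  assumes "\<And>n. closed_under_limits (P n)"
  shows "initial_data \<kappa> \<omega> (\<lambda>\<theta>. \<exists>n. P n \<theta>) = (\<Union>n. initial_data \<kappa> \<omega> (P n))"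
proof -
  have "P n \<eta>" if "is_solution \<kappa> \<omega> x \<theta>" "is_solution \<kappa> \<omega> x \<eta>" "P n \<theta>" for x \<theta> \<eta> n
    by (rule closed_under_limits_solution_unique[OF assms that])
  then have "(\<forall>\<theta>. is_solution \<kappa> \<omega> x \<theta> \<longrightarrow> (\<exists>n. P n \<theta>)) \<longleftrightarrow>
      (\<exists>n. \<forall>\<theta>. is_solution \<kappa> \<omega> x \<theta> \<longrightarrow> P n \<theta>)" for x
    by metis
  then show ?thesis unfolding initial_data_def by auto
qed

lemma cSUP_diff_cINF_le_iff:
  fixes f :: "'a \<Rightarrow> real"
  assumes "S \<noteq> {}"
  shows "bdd_above (f ` S) \<and> bdd_below (f ` S) \<and> (SUP x\<in>S. f x) - (INF x\<in>S. f x) \<le> M \<longleftrightarrow>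
    (\<forall>x\<in>S. \<forall>y\<in>S. f x - f y \<le> M)"
proof (intro iffI conjI ballI)
  fix x y
  assume "bdd_above (f ` S) \<and> bdd_below (f ` S) \<and> (SUP x\<in>S. f x) - (INF x\<in>S. f x) \<le> M"
    and "x \<in> S" "y \<in> S"
  then show "f x - f y \<le> M"
    using cSUP_upper[of x S f] cINF_lower[of f S y] by linarith
next
  assume bound: "\<forall>x\<in>S. \<forall>y\<in>S. f x - f y \<le> M"
  obtain z where z: "z \<in> S" using assms by blast
  show "bdd_above (f ` S)" "bdd_below (f ` S)"
    using bound z by (force intro!: bdd_aboveI[where M = "f z + M"] bdd_belowI[where m = "f z - M"])+
  have "(SUP x\<in>S. f x) \<le> M + f y" if "y \<in> S" for y
    using bound that assms by (intro cSUP_least) (auto simp: algebra_simps)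
  then have "(SUP x\<in>S. f x) - M \<le> (INF x\<in>S. f x)"
    using assms by (intro cINF_greatest) (auto simp: algebra_simps)
  then show "(SUP x\<in>S. f x) - (INF x\<in>S. f x) \<le> M" by simp
qed

lemma osc_bounded_iff:
  "osc_bounded \<theta> i \<longleftrightarrow> (\<exists>M<2 * pi. osc_at_most M \<theta> i)"
proof -
  have "osc_bounded \<theta> i \<longleftrightarrow> (\<exists>M<2 * pi. bdd_above ((\<lambda>t. \<theta> t $ i) ` {0..}) \<and>
      bdd_below ((\<lambda>t. \<theta> t $ i) ` {0..}) \<and> (SUP t\<in>{0..}. \<theta> t $ i) - (INF t\<in>{0..}. \<theta> t $ i) \<le> M)"
    unfolding osc_bounded_def by (auto intro: le_less_trans)
  then show ?thesis
    using cSUP_diff_cINF_le_iff[of "{0..}" "\<lambda>t. \<theta> t $ i"] by (simp add: osc_at_most_def Ball_def)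
qed

lemma osc_bounded_iff_nat:
  "osc_bounded \<theta> i \<longleftrightarrow> (\<exists>n::nat. osc_at_most (2 * pi - 1 / real (Suc n)) \<theta> i)"
proof
  assume "osc_bounded \<theta> i"
  then obtain M where "M < 2 * pi" and M: "osc_at_most M \<theta> i"
    unfolding osc_bounded_iff by blast
  then obtain n where "1 / real (Suc n) < 2 * pi - M"
    using nat_approx_posE[of "2 * pi - M"] by auto
  with M have "osc_at_most (2 * pi - 1 / real (Suc n)) \<theta> i"
    unfolding osc_at_most_def by (smt (verit))
  then show "\<exists>n::nat. osc_at_most (2 * pi - 1 / real (Suc n)) \<theta> i" ..
next
  assume "\<exists>n::nat. osc_at_most (2 * pi - 1 / real (Suc n)) \<theta> i"
  then obtain n :: nat where "osc_at_most (2 * pi - 1 / real (Suc n)) \<theta> i" ..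
  moreover have "2 * pi - 1 / real (Suc n) < 2 * pi" by simp
  ultimately show "osc_bounded \<theta> i"
    unfolding osc_bounded_iff by blast
qed

lemma initial_data_osc_bounded_in_borel:
  fixes \<omega> :: "real^'n"
  shows "initial_data \<kappa> \<omega> (\<lambda>\<theta>. \<forall>i. osc_bounded \<theta> i) \<in> sets borel"
proof -
  have "initial_data \<kappa> \<omega> (\<lambda>\<theta>. osc_bounded \<theta> i) \<in> sets borel" for i
    unfolding osc_bounded_iff_nat
    by (subst initial_data_Ex)
      (intro sets.countable_UN image_subsetI initial_data_in_borel closed_under_limits_osc_at_most)+
  moreover have "initial_data \<kappa> \<omega> (\<lambda>\<theta>. \<forall>i. osc_bounded \<theta> i) =
      (\<Inter>i. initial_data \<kappa> \<omega> (\<lambda>\<theta>. osc_bounded \<theta> i))"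
    by (auto simp: initial_data_def)
  ultimately show ?thesis by (simp add: sets.finite_INT)
qed

subsection \<open>Persistence of the order parameter\<close>

lemma abs_le_Omega_inf: "\<bar>\<omega> $ i\<bar> \<le> Omega_inf \<omega>"
  unfolding Omega_inf_def by (rule Max_ge) auto

lemma Omega_inf_nonneg: "0 \<le> Omega_inf \<omega>"
  using abs_le_Omega_inf[of \<omega>] abs_ge_zero by (rule order_trans[rotated])

lemma abs_le_pi_if_in_cube: "x \<in> cube \<Longrightarrow> \<bar>x $ i\<bar> \<le> pi"
  by (auto simp: cube_def abs_le_iff minus_le_iff)

text \<open>The amount of \<open>1 + cos\<close> that an oscillator starting at \<open>x\<close> is guaranteed to keep as long
  as the coupling dominates the natural frequencies outside the \<open>\<alpha>\<close>-neighbourhoods of \<open>0\<close> and \<open>pi\<close>.\<close>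

definition retained_order :: "real \<Rightarrow> real \<Rightarrow> real" where
  "retained_order \<alpha> x = (if \<bar>x\<bar> \<le> pi - \<alpha> then 1 + cos (max \<bar>x\<bar> \<alpha>) else 0)"

lemma retained_order_nonneg: "0 \<le> retained_order \<alpha> x"
  unfolding retained_order_def using cos_ge_minus_one[of "max \<bar>x\<bar> \<alpha>"] by (smt (verit))

lemma retained_order_le:
  assumes "0 \<le> \<alpha>"
  shows "retained_order \<alpha> x \<le> 1 + cos x"
proof -
  have "cos (max \<bar>x\<bar> \<alpha>) \<le> cos \<bar>x\<bar>" if "\<bar>x\<bar> \<le> pi - \<alpha>"
    using assms that by (intro cos_monotone_0_pi_le) auto
  then show ?thesis
    unfolding retained_order_def using cos_ge_minus_one[of x] cos_abs_real[of x] by (smt (verit))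
qed

lemma retained_order_upper:
  assumes "0 \<le> \<alpha>" "\<alpha> \<le> pi"
  shows "retained_order \<alpha> x \<le> 1 + cos \<alpha>"
proof -
  have "cos (max \<bar>x\<bar> \<alpha>) \<le> cos \<alpha>" if "\<bar>x\<bar> \<le> pi - \<alpha>"
    using assms that by (intro cos_monotone_0_pi_le) auto
  then show ?thesis
    unfolding retained_order_def using cos_ge_minus_one[of \<alpha>] by (smt (verit))
qed

lemma retained_order_lower:
  assumes "0 \<le> \<alpha>" "\<alpha> \<le> pi" "\<bar>x\<bar> \<le> pi"
  shows "1 + cos x - (1 - cos \<alpha>) \<le> retained_order \<alpha> x"
proof (cases "\<bar>x\<bar> \<le> pi - \<alpha>")
  case True
  then show ?thesis
    using cos_le_one[of x] cos_le_one[of \<alpha>] by (auto simp: retained_order_def max_def)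
next
  case False
  then have "cos \<bar>x\<bar> \<le> cos (pi - \<alpha>)" using assms by (intro cos_monotone_0_pi_le) auto
  then show ?thesis using False by (simp add: retained_order_def)
qed

lemma (in driven_phase) retained_order_le_cos:
  assumes "s \<in> J" "t \<in> J" "s \<le> t"
  shows "retained_order \<alpha> (y s) \<le> 1 + cos (y t)"
proof -
  have "cos (max \<bar>y s\<bar> \<alpha>) \<le> cos \<bar>y t\<bar>" if "\<bar>y s\<bar> \<le> pi - \<alpha>"
    using abs_le_max[OF assms that] that alpha by (intro cos_monotone_0_pi_le) auto
  then show ?thesis
    unfolding retained_order_def using cos_ge_minus_one[of "y t"] cos_abs_real[of "y t"]
    by (smt (verit))
qed

lemma is_solution_component_deriv:
  fixes \<theta> :: "real \<Rightarrow> real^'n"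
  assumes "is_solution \<kappa> \<omega> x \<theta>" "t \<ge> 0"
  shows "((\<lambda>t. \<theta> t $ i) has_real_derivative \<omega> $ i - \<kappa> * order_R \<theta> t * sin (\<theta> t $ i))
    (at t within {0..})"
proof -
  have "(\<theta> has_vector_derivative kura_rhs \<kappa> \<omega> (\<theta> t)) (at t within {0..})"
    using assms by (simp add: is_solution_def)
  then have "((\<lambda>t. \<theta> t $ i) has_vector_derivative kura_rhs \<kappa> \<omega> (\<theta> t) $ i) (at t within {0..})"
    by (rule bounded_linear.has_vector_derivative[OF bounded_linear_vec_nth])
  then show ?thesis
    by (simp add: has_real_derivative_iff_has_vector_derivative kura_rhs_def order_R_def)
qed

lemma is_solution_order_R_continuous:
  assumes "is_solution \<kappa> \<omega> x \<theta>"
  shows "continuous_on {0..} (order_R \<theta>)"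
proof -
  have "continuous_on {0..} \<theta>"
    by (rule continuous_on_vector_derivative) (use assms in \<open>auto simp: is_solution_def\<close>)
  then show ?thesis
    unfolding order_R_def[abs_def] by (intro continuous_intros)
qed

locale kuramoto_solution =
  fixes \<kappa> :: real and \<omega> x :: "real^'n" and \<theta> :: "real \<Rightarrow> real^'n" and r \<alpha> :: real
  assumes solution: "is_solution \<kappa> \<omega> x \<theta>" and kappa_pos: "0 < \<kappa>"
    and alpha: "0 < \<alpha>" "\<alpha> < pi/2"
    and strong: "Omega_inf \<omega> < \<kappa> * r * sin \<alpha>"
begin

lemma initial_value: "\<theta> 0 = x"
  using solution by (simp add: is_solution_def)

lemma driven_phase_component:
  assumes "is_interval J" "J \<subseteq> {0..}" "\<And>t. t \<in> J \<Longrightarrow> r \<le> order_R \<theta> t"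
  shows "driven_phase J (\<lambda>t. \<theta> t $ i) (\<lambda>t. \<kappa> * order_R \<theta> t) (\<omega> $ i) (\<kappa> * r) \<alpha>"
proof
  fix t assume "t \<in> J"
  then show "((\<lambda>t. \<theta> t $ i) has_real_derivative \<omega> $ i - \<kappa> * order_R \<theta> t * sin (\<theta> t $ i))
      (at t within J)"
    using assms(2) by (intro DERIV_subset[OF is_solution_component_deriv[OF solution]]) auto
  show "\<kappa> * r \<le> \<kappa> * order_R \<theta> t"
    using assms(3) \<open>t \<in> J\<close> kappa_pos by (intro mult_left_mono) auto
qed (use assms alpha strong abs_le_Omega_inf[of \<omega> i] in auto)

lemma coherent_if_retained_order:
  assumes start: "real CARD('n) * r < (\<Sum>i\<in>UNIV. retained_order \<alpha> (x $ i))"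
  shows "coherent r \<theta>"
proof -
  have above: "r < order_R \<theta> T" if "\<And>i. retained_order \<alpha> (x $ i) \<le> 1 + cos (\<theta> T $ i)" for T
  proof -
    have "real CARD('n) * r < (\<Sum>i\<in>UNIV. 1 + cos (\<theta> T $ i))"
      by (rule less_le_trans[OF start sum_mono]) (rule that)
    then show ?thesis by (simp add: order_R_def field_simps)
  qed
  have "r < order_R \<theta> t" if "t \<ge> 0" for t
  proof (rule bootstrap_lower_bound[OF is_solution_order_R_continuous[OF solution] _ _ that])
    show "r < order_R \<theta> 0"
      using alpha by (intro above) (simp add: initial_value retained_order_le)
    fix T :: real assume T: "T \<ge> 0" "\<And>t. t \<in> {0..T} \<Longrightarrow> r \<le> order_R \<theta> t"
    show "r < order_R \<theta> T"
    proof (rule above)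
      fix i
      interpret driven_phase "{0..T}" "\<lambda>t. \<theta> t $ i" "\<lambda>t. \<kappa> * order_R \<theta> t" "\<omega> $ i" "\<kappa> * r" \<alpha>
        by (rule driven_phase_component) (use T in auto)
      show "retained_order \<alpha> (x $ i) \<le> 1 + cos (\<theta> T $ i)"
        using retained_order_le_cos[of 0 T] T by (simp add: initial_value)
    qed
  qed
  then show ?thesis by (simp add: coherent_def less_imp_le)
qed

context
  assumes coherent: "coherent r \<theta>"
begin

interpretation component:
  driven_phase "{0..}" "\<lambda>t. \<theta> t $ i" "\<lambda>t. \<kappa> * order_R \<theta> t" "\<omega> $ i" "\<kappa> * r" \<alpha> for i
  by (rule driven_phase_component) (use coherent in \<open>auto simp: coherent_def\<close>)

lemma osc_bounded_component:
  assumes "x \<in> cube"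
  shows "osc_bounded \<theta> i"
  unfolding osc_bounded_iff
proof (intro exI conjI)
  show "max (2 * pi - 2 * \<alpha>) (pi + 2 * \<alpha>) < 2 * pi" using alpha by simp
  show "osc_at_most (max (2 * pi - 2 * \<alpha>) (pi + 2 * \<alpha>)) \<theta> i"
    unfolding osc_at_most_def
    using component.oscillation_le[of 0] abs_le_pi_if_in_cube[OF assms] by (simp add: initial_value)
qed

lemma cos_component_trapped:
  assumes "s \<ge> 0" "t \<ge> s" and "cos (pi - \<alpha>) \<le> cos (\<theta> s $ i)"
  shows "cos (pi - \<alpha>) \<le> cos (\<theta> t $ i)"
    and "pi - 2 * \<alpha> \<le> (\<kappa> * r * sin \<alpha> - Omega_inf \<omega>) * (t - s) \<Longrightarrow> cos \<alpha> \<le> cos (\<theta> t $ i)"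
proof -
  show "cos (pi - \<alpha>) \<le> cos (\<theta> t $ i)"
    using component.cos_trapped(1)[of s t i] assms by simp
  assume "pi - 2 * \<alpha> \<le> (\<kappa> * r * sin \<alpha> - Omega_inf \<omega>) * (t - s)"
  also have "\<dots> \<le> (\<kappa> * r * sin \<alpha> - \<bar>\<omega> $ i\<bar>) * (t - s)"
    using assms abs_le_Omega_inf[of \<omega> i] by (intro mult_right_mono) auto
  finally show "cos \<alpha> \<le> cos (\<theta> t $ i)"
    using component.cos_trapped(2)[of s t i] assms by simp
qed

end

end

lemma angle_with_cos_one_minus_square:
  assumes "0 < q" "q < (1::real)"
  obtains \<alpha> where "0 < \<alpha>" "\<alpha> < pi/2" "cos \<alpha> = 1 - q\<^sup>2" "q < sin \<alpha>"
proof
  let ?\<alpha> = "arccos (1 - q\<^sup>2)"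
  have square: "0 < q\<^sup>2" "q\<^sup>2 < 1" using assms by (auto simp: power_less_one_iff)
  then show cos: "cos ?\<alpha> = 1 - q\<^sup>2" by (intro cos_arccos) auto
  show pos: "0 < ?\<alpha>" using arccos_less_arccos[of "1 - q\<^sup>2" 1] square by simp
  show less: "?\<alpha> < pi/2" using arccos_less_arccos[of 0 "1 - q\<^sup>2"] square by simp
  show "q < sin ?\<alpha>"
  proof (rule power_less_imp_less_base)
    have "q\<^sup>2 * q\<^sup>2 < q\<^sup>2 * 1" using square by (intro mult_strict_left_mono) auto
    then show "q\<^sup>2 < (sin ?\<alpha>)\<^sup>2"
      unfolding sin_squared_eq cos by (simp add: power2_eq_square algebra_simps)
    show "0 \<le> sin ?\<alpha>" using pos less by (intro sin_ge_zero) auto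
  qed
qed

text \<open>With \<open>cos \<alpha> = 1 - q\<^sup>2\<close> the order parameter can lose at most \<open>q\<^sup>2\<close>, and the remaining
  \<open>q\<^sup>2\<close> confines the phases because \<open>sin \<alpha> > q\<close>.\<close>

lemma osc_bounded_if_initially_spread:
  fixes \<theta> :: "real \<Rightarrow> real^'n"
  assumes "is_solution \<kappa> \<omega> x \<theta>" and "x \<in> cube" "0 < \<kappa>"
    and q: "0 < q" "q < 1" "Omega_inf \<omega> \<le> \<kappa> * q ^ 3"
    and start: "real CARD('n) * (2 * q\<^sup>2) < (\<Sum>i\<in>UNIV. 1 + cos (x $ i))"
  shows "osc_bounded \<theta> i"
proof -
  obtain \<alpha> where alpha: "0 < \<alpha>" "\<alpha> < pi/2" and cos: "cos \<alpha> = 1 - q\<^sup>2" and "q < sin \<alpha>"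
    using angle_with_cos_one_minus_square q(1,2) .
  then have "\<kappa> * q\<^sup>2 * q < \<kappa> * q\<^sup>2 * sin \<alpha>"
    using \<open>0 < \<kappa>\<close> q(1) by (intro mult_strict_left_mono) auto
  then have strong: "Omega_inf \<omega> < \<kappa> * q\<^sup>2 * sin \<alpha>"
    using q(3) by (simp add: power2_eq_square power3_eq_cube mult_ac)
  interpret kuramoto_solution \<kappa> \<omega> x \<theta> "q\<^sup>2" \<alpha>
    by unfold_locales fact+
  have "real CARD('n) * q\<^sup>2 < (\<Sum>i\<in>UNIV. 1 + cos (x $ i)) - real CARD('n) * q\<^sup>2"
    using start by (simp add: algebra_simps)
  also have "\<dots> = (\<Sum>i\<in>UNIV. 1 + cos (x $ i) - (1 - cos \<alpha>))"
    by (simp add: cos sum_subtractf)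
  also have "\<dots> \<le> (\<Sum>i\<in>UNIV. retained_order \<alpha> (x $ i))"
    using alpha by (intro sum_mono retained_order_lower abs_le_pi_if_in_cube[OF \<open>x \<in> cube\<close>]) auto
  finally have "coherent (q\<^sup>2) \<theta>" by (rule coherent_if_retained_order)
  then show ?thesis using \<open>x \<in> cube\<close> by (rule osc_bounded_component)
qed

subsection \<open>Trapping of the phases\<close>

definition order_level :: "real \<Rightarrow> real" where
  "order_level \<epsilon> = 1 / sqrt 2 - 3 * \<epsilon> / 20"

lemma sqrt_2_less: "sqrt 2 < 3/2"
  by (rule real_less_lsqrt) (simp_all add: power2_eq_square)

lemma order_level_margin:
  fixes \<kappa> \<epsilon> :: real
  assumes "0 < \<kappa>" "0 < \<epsilon>" "\<epsilon> \<le> 1"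
  shows "\<kappa> / (2 + \<epsilon>) \<le> \<kappa> * order_level \<epsilon> * sin (pi/4)"
proof -
  have "1 / (2 + \<epsilon>) \<le> 1/2 - \<epsilon>/6"
    using assms mult_right_mono[of \<epsilon> 1 \<epsilon>] by (simp add: field_simps)
  also have "\<dots> \<le> 1/2 - 3 * sqrt 2 * \<epsilon> / 40"
    using sqrt_2_less assms by (simp add: field_simps)
  also have "\<dots> = order_level \<epsilon> * sin (pi/4)"
    by (simp add: order_level_def sin_45 field_simps)
  finally show ?thesis
    using mult_left_mono[of "1 / (2 + \<epsilon>)" _ \<kappa>] assms(1) by (simp add: mult.assoc)
qed

lemma cos_pi_quarter: "cos (pi/4) = 1 / sqrt 2"
  by (simp add: cos_45 field_simps)

lemma cos_pi_minus_pi_quarter: "cos (pi - pi/4) = - 1 / sqrt 2"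
  unfolding cos_pi_minus cos_pi_quarter by simp

lemma kuramoto_solution_order_level:
  fixes \<omega> :: "real^'n"
  assumes "is_solution \<kappa> \<omega> x \<theta>" "0 < \<kappa>" "0 < \<epsilon>" "\<epsilon> \<le> 1" "(2 + \<epsilon>) * Omega_inf \<omega> < \<kappa>"
  shows "kuramoto_solution \<kappa> \<omega> x \<theta> (order_level \<epsilon>) (pi/4)"
proof
  have "Omega_inf \<omega> < \<kappa> / (2 + \<epsilon>)" using assms by (simp add: field_simps)
  also have "\<dots> \<le> \<kappa> * order_level \<epsilon> * sin (pi/4)" by (rule order_level_margin) fact+
  finally show "Omega_inf \<omega> < \<kappa> * order_level \<epsilon> * sin (pi/4)" .
qed (use assms in auto)

definition phases_trapped :: "real \<Rightarrow> (real \<Rightarrow> real^'n) \<Rightarrow> bool" where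
  "phases_trapped \<tau> \<theta> \<longleftrightarrow> (\<forall>i. \<forall>t0\<ge>0. cos (\<theta> t0 $ i) \<ge> - 1 / sqrt 2 \<longrightarrow>
    (\<forall>t\<ge>t0. cos (\<theta> t $ i) \<ge> - 1 / sqrt 2) \<and> (\<forall>t\<ge>t0 + \<tau>. cos (\<theta> t $ i) \<ge> 1 / sqrt 2))"

definition trapping_time :: "real \<Rightarrow> real^'n \<Rightarrow> real \<Rightarrow> real" where
  "trapping_time \<kappa> \<omega> \<epsilon> = (2 + \<epsilon>) * pi / (\<kappa> - (2 + \<epsilon>) * Omega_inf \<omega>)"

lemma phases_trapped_if_coherent:
  fixes \<omega> :: "real^'n"
  assumes "is_solution \<kappa> \<omega> x \<theta>" and "0 < \<kappa>" and eps: "0 < \<epsilon>" "\<epsilon> \<le> 1"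
    and kappa: "(2 + \<epsilon>) * Omega_inf \<omega> < \<kappa>"
    and coherent: "coherent (order_level \<epsilon>) \<theta>"
  shows "phases_trapped (trapping_time \<kappa> \<omega> \<epsilon>) \<theta>"
  unfolding phases_trapped_def
proof (intro allI impI conjI)
  interpret kuramoto_solution \<kappa> \<omega> x \<theta> "order_level \<epsilon>" "pi/4"
    by (rule kuramoto_solution_order_level) fact+
  note trapped = cos_component_trapped[OF coherent, unfolded cos_pi_minus_pi_quarter cos_pi_quarter]
  fix i and s t :: real
  assume start: "s \<ge> 0" "- 1 / sqrt 2 \<le> cos (\<theta> s $ i)"
  then show "- 1 / sqrt 2 \<le> cos (\<theta> t $ i)" if "t \<ge> s"
    using trapped(1) start that by blast
  define D where "D = \<kappa> - (2 + \<epsilon>) * Omega_inf \<omega>"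
  have D: "D > 0" using kappa by (simp add: D_def)
  have \<tau>: "trapping_time \<kappa> \<omega> \<epsilon> = (2 + \<epsilon>) * pi / D"
    by (simp add: trapping_time_def D_def)
  assume t: "s + trapping_time \<kappa> \<omega> \<epsilon> \<le> t"
  moreover have "0 \<le> trapping_time \<kappa> \<omega> \<epsilon>" using D eps by (simp add: \<tau>)
  ultimately have "s \<le> t" by simp
  have "pi - 2 * (pi/4) \<le> (D / (2 + \<epsilon>)) * trapping_time \<kappa> \<omega> \<epsilon>"
    using D eps by (simp add: \<tau>)
  also have "\<dots> \<le> (D / (2 + \<epsilon>)) * (t - s)"
    using t D eps by (intro mult_left_mono) auto
  also have "\<dots> \<le> (\<kappa> * order_level \<epsilon> * sin (pi/4) - Omega_inf \<omega>) * (t - s)"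
    using order_level_margin[OF \<open>0 < \<kappa>\<close> eps] \<open>s \<le> t\<close> eps
    by (intro mult_right_mono) (auto simp: D_def diff_divide_distrib)
  finally show "1 / sqrt 2 \<le> cos (\<theta> t $ i)"
    using trapped(2) start \<open>s \<le> t\<close> by blast
qed

lemma initial_data_conditions_eq:
  fixes \<omega> :: "real^'n"
  assumes "0 < \<kappa>" "0 < \<epsilon>" "\<epsilon> \<le> 1" "(2 + \<epsilon>) * Omega_inf \<omega> < \<kappa>"
  shows "initial_data \<kappa> \<omega> (\<lambda>\<theta>. coherent (order_level \<epsilon>) \<theta> \<and> (\<forall>i. osc_bounded \<theta> i) \<and>
      phases_trapped (trapping_time \<kappa> \<omega> \<epsilon>) \<theta>) = initial_data \<kappa> \<omega> (coherent (order_level \<epsilon>))"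
proof -
  have "osc_bounded \<theta> i \<and> phases_trapped (trapping_time \<kappa> \<omega> \<epsilon>) \<theta>"
    if "x \<in> cube" "is_solution \<kappa> \<omega> x \<theta>" "coherent (order_level \<epsilon>) \<theta>" for x \<theta> i
    using kuramoto_solution.osc_bounded_component[OF kuramoto_solution_order_level[OF that(2) assms]]
      phases_trapped_if_coherent[OF that(2) assms] that by blast
  then show ?thesis unfolding initial_data_def by blast
qed

subsection \<open>Chernoff bounds on the cube\<close>

lemma nn_integral_lborel_prod_cart:
  fixes f :: "real \<Rightarrow> ennreal"
  assumes [measurable]: "f \<in> borel_measurable borel"
  shows "(\<integral>\<^sup>+x. (\<Prod>i\<in>UNIV. f (x $ i)) \<partial>(lborel :: (real^'n) measure))
    = (\<integral>\<^sup>+x. f x \<partial>lborel) ^ CARD('n)"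
proof -
  have Basis: "(Basis :: (real^'n) set) = range (\<lambda>i. axis i 1)" by (auto simp: Basis_vec_def)
  have inj: "inj (\<lambda>i::'n. axis i (1::real))" by (auto simp: inj_def axis_eq_axis)
  have "(\<integral>\<^sup>+x. (\<Prod>i\<in>UNIV. f (x $ i)) \<partial>(lborel :: (real^'n) measure))
      = (\<integral>\<^sup>+x. (\<Prod>b\<in>Basis. f (x \<bullet> b)) \<partial>(lborel :: (real^'n) measure))"
    unfolding Basis by (subst prod.reindex[OF inj]) (simp add: cart_eq_inner_axis)
  also have "\<dots> = (\<Prod>b\<in>(Basis :: (real^'n) set). \<integral>\<^sup>+x. f x \<partial>lborel)"
    by (rule nn_integral_lborel_prod) auto
  finally show ?thesis by simp
qed

lemma emeasure_lborel_le_chernoff: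
  fixes f :: "real \<Rightarrow> real"
  assumes [measurable]: "f \<in> borel_measurable borel" "A \<in> sets borel" and "l \<ge> 0"
  shows "emeasure lborel {x::real^'n. (\<forall>i. x $ i \<in> A) \<and> (\<Sum>i\<in>UNIV. f (x $ i)) \<le> real CARD('n) * c}
    \<le> (\<integral>\<^sup>+x\<in>A. exp (l * (c - f x)) \<partial>lborel) ^ CARD('n)"
proof -
  define g where "g x = ennreal (exp (l * (c - f x))) * indicator A x" for x
  have [measurable]: "g \<in> borel_measurable borel" unfolding g_def by measurable
  define E where "E = {x::real^'n. (\<forall>i. x $ i \<in> A) \<and> (\<Sum>i\<in>UNIV. f (x $ i)) \<le> real CARD('n) * c}"
  have [measurable]: "E \<in> sets borel" unfolding E_def by measurable
  have "indicator E x \<le> (\<Prod>i\<in>UNIV. g (x $ i))" for x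
  proof (cases "x \<in> E")
    case True
    then have "(\<Sum>i\<in>UNIV. f (x $ i)) \<le> real CARD('n) * c" by (simp add: E_def)
    then have "0 \<le> l * (\<Sum>i\<in>UNIV. c - f (x $ i))"
      using \<open>l \<ge> 0\<close> by (simp add: sum_subtractf)
    then have "1 \<le> (\<Prod>i\<in>UNIV. exp (l * (c - f (x $ i))))"
      by (simp add: sum_distrib_left flip: exp_sum)
    then have "1 \<le> (\<Prod>i\<in>UNIV. ennreal (exp (l * (c - f (x $ i)))))"
      by (simp add: prod_ennreal)
    also have "\<dots> = (\<Prod>i\<in>UNIV. g (x $ i))"
      using True by (intro prod.cong) (auto simp: g_def E_def)
    finally show ?thesis using True by simp
  qed simp
  then have "(\<integral>\<^sup>+x. indicator E x \<partial>lborel)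
      \<le> (\<integral>\<^sup>+x. (\<Prod>i\<in>UNIV. g (x $ i)) \<partial>(lborel :: (real^'n) measure))"
    by (intro nn_integral_mono) auto
  also have "\<dots> = (\<integral>\<^sup>+x. g x \<partial>lborel) ^ CARD('n)"
    by (rule nn_integral_lborel_prod_cart) measurable
  finally show ?thesis by (simp add: E_def g_def)
qed

lemma emeasure_lborel_cube:
  "emeasure lborel (cube :: (real^'n) set) = ennreal ((2 * pi) ^ CARD('n))"
proof -
  have "emeasure lborel (cube :: (real^'n) set) =
      (\<Prod>b\<in>Basis. ((\<chi> i. pi) - (\<chi> i. - pi) :: real^'n) \<bullet> b)"
    unfolding cube_eq_cbox by (rule emeasure_lborel_cbox) (auto simp: Basis_vec_def inner_axis)
  also have "(\<Prod>b\<in>Basis. ((\<chi> i. pi) - (\<chi> i. - pi) :: real^'n) \<bullet> b) =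
      (\<Prod>b\<in>(Basis :: (real^'n) set). 2 * pi)"
    by (rule prod.cong) (auto simp: Basis_vec_def inner_axis)
  finally show ?thesis by simp
qed

definition low_sum :: "(real \<Rightarrow> real) \<Rightarrow> real \<Rightarrow> (real^'n) set" where
  "low_sum f c = {x \<in> cube. (\<Sum>i\<in>UNIV. f (x $ i)) \<le> real CARD('n) * c}"

lemma low_sum_in_borel:
  assumes [measurable]: "f \<in> borel_measurable borel"
  shows "(low_sum f c :: (real^'n) set) \<in> sets borel"
proof -
  have "low_sum f c =
      {x :: real^'n \<in> space borel. x \<in> cube \<and> (\<Sum>i\<in>UNIV. f (x $ i)) \<le> real CARD('n) * c}"
    by (simp add: low_sum_def)
  also have "\<dots> \<in> sets borel" by measurable
  finally show ?thesis .
qed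

lemma norm_meas_low_sum_le_chernoff:
  fixes f :: "real \<Rightarrow> real"
  assumes f: "f \<in> borel_measurable borel" and "l \<ge> 0"
    and bound: "(\<integral>\<^sup>+x\<in>{-pi..pi}. exp (l * (c - f x)) \<partial>lborel) \<le> ennreal (2 * pi * q)" "q \<ge> 0"
  shows "norm_meas (low_sum f c :: (real^'n) set) \<le> q ^ CARD('n)"
proof -
  let ?E = "low_sum f c :: (real^'n) set"
  have "measure lebesgue ?E = measure lborel ?E"
    by (simp add: low_sum_in_borel[OF f])
  also have "\<dots> \<le> (2 * pi * q) ^ CARD('n)"
    unfolding measure_def
  proof (rule enn2real_leI)
    have "emeasure lborel ?E \<le> (\<integral>\<^sup>+x\<in>{-pi..pi}. exp (l * (c - f x)) \<partial>lborel) ^ CARD('n)"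
      using emeasure_lborel_le_chernoff[OF f, of "{-pi..pi}" l c] \<open>l \<ge> 0\<close>
      by (simp add: low_sum_def cube_def)
    also have "\<dots> \<le> ennreal (2 * pi * q) ^ CARD('n)"
      using bound(1) by (rule power_mono) simp
    finally show "emeasure lborel ?E \<le> ennreal ((2 * pi * q) ^ CARD('n))"
      using bound(2) by (simp add: ennreal_power)
  qed (use bound(2) in simp)
  finally show ?thesis
    by (simp add: norm_meas_def power_mult_distrib field_simps)
qed

lemma norm_meas_initial_data_ge:
  fixes \<omega> :: "real^'n"
  assumes "initial_data \<kappa> \<omega> P \<in> sets borel" and f: "f \<in> borel_measurable borel"
    and good: "\<And>x \<theta>. \<lbrakk>x \<in> cube; real CARD('n) * c < (\<Sum>i\<in>UNIV. f (x $ i));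
      is_solution \<kappa> \<omega> x \<theta>\<rbrakk> \<Longrightarrow> P \<theta>"
  shows "1 - norm_meas (low_sum f c :: (real^'n) set) \<le> norm_meas (initial_data \<kappa> \<omega> P)"
proof -
  let ?S = "initial_data \<kappa> \<omega> P" and ?B = "low_sum f c :: (real^'n) set"
  have borel: "?S \<in> sets borel" "?B \<in> sets borel" "?S \<union> ?B \<subseteq> cube"
    using assms(1) by (auto simp: low_sum_in_borel[OF f]) (auto simp: initial_data_def low_sum_def)
  have fin: "C \<in> fmeasurable lborel" if "C \<in> sets borel" "C \<subseteq> cube" for C :: "(real^'n) set"
    by (rule fmeasurableI2[of cube]) (use that in \<open>auto simp: fmeasurable_def emeasure_lborel_cube\<close>)
  have "(2 * pi) ^ CARD('n) = measure lborel (cube :: (real^'n) set)"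
    by (simp add: measure_def emeasure_lborel_cube)
  also have "\<dots> \<le> measure lborel (?S \<union> ?B)"
    using good borel
    by (intro measure_mono_fmeasurable fin) (force simp: initial_data_def low_sum_def)+
  also have "\<dots> \<le> measure lborel ?S + measure lborel ?B"
    using borel by (intro measure_Un_le) auto
  finally have "(2 * pi) ^ CARD('n) \<le> measure lebesgue ?S + measure lebesgue ?B"
    using borel by simp
  from divide_right_mono[OF this, of "(2 * pi) ^ CARD('n)"] show ?thesis
    by (simp add: norm_meas_def add_divide_distrib)
qed

subsection \<open>Hoeffding's inequality on the cube\<close>

lemma (in interval_bounded_random_variable) Hoeffdings_lemma_below_mean:
  assumes "l > 0"
  shows "(\<integral>\<^sup>+x. exp (l * (expectation f - f x)) \<partial>M) \<le> ennreal (exp (l\<^sup>2 * (b - a)\<^sup>2 / 8))"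
proof -
  interpret uminus: interval_bounded_random_variable M "\<lambda>x. - f x" "- b" "- a"
    by unfold_locales (use AE_in_interval in auto)
  show ?thesis
    using uminus.Hoeffdings_lemma_nn_integral[OF assms] by (simp add: algebra_simps)
qed

lemma expectation_uniform_measure_Icc:
  fixes f :: "real \<Rightarrow> real"
  assumes "a < b" and [measurable]: "f \<in> borel_measurable borel"
    and "integrable (uniform_measure lborel {a..b}) f"
  shows "(\<integral>x. f x \<partial>uniform_measure lborel {a..b}) = integral {a..b} f / (b - a)"
proof -
  have density: "uniform_measure lborel {a..b} =
      density lborel (\<lambda>x. ennreal (indicator {a..b} x / (b - a)))"
    unfolding uniform_measure_def
    using \<open>a < b\<close> by (intro density_cong) (auto simp: indicator_def simp flip: divide_ennreal)
  have "integrable lborel (\<lambda>x. indicator {a..b} x / (b - a) * f x)"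
    using assms(3) \<open>a < b\<close> unfolding density by (subst (asm) integrable_density) auto
  then have "integrable lborel (\<lambda>x. (b - a) * (indicator {a..b} x / (b - a) * f x))"
    by (rule integrable_mult_right)
  then have "set_integrable lborel {a..b} f"
    using \<open>a < b\<close> by (simp add: set_integrable_def)
  then have "(LINT x:{a..b}|lborel. f x) = integral {a..b} f"
    by (rule set_borel_integral_eq_integral)
  moreover have "(\<integral>x. f x \<partial>uniform_measure lborel {a..b}) = (LINT x:{a..b}|lborel. f x) / (b - a)"
    using \<open>a < b\<close> unfolding density set_lebesgue_integral_def
    by (subst integral_density) auto
  ultimately show ?thesis by simp
qed

lemma set_nn_integral_exp_le_Hoeffding:
  fixes f :: "real \<Rightarrow> real"
  assumes "a < b" and f [measurable]: "f \<in> borel_measurable borel"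
    and bounds: "\<And>x. x \<in> {a..b} \<Longrightarrow> f x \<in> {m..M}"
    and mean: "(f has_integral (b - a) * \<mu>) {a..b}" and "l > 0"
  shows "(\<integral>\<^sup>+x\<in>{a..b}. exp (l * (c - f x)) \<partial>lborel)
    \<le> ennreal ((b - a) * exp (l * (c - \<mu>) + l\<^sup>2 * (M - m)\<^sup>2 / 8))"
proof -
  let ?U = "uniform_measure lborel {a..b}"
  have "prob_space ?U"
    using \<open>a < b\<close> by (intro prob_space_uniform_measure) auto
  then interpret interval_bounded_random_variable ?U f m M
    unfolding interval_bounded_random_variable_def interval_bounded_random_variable_axioms_def
    using bounds by (auto intro!: AE_uniform_measureI)
  have "expectation f = \<mu>"
    using expectation_uniform_measure_Icc[OF \<open>a < b\<close> f integrable] mean \<open>a < b\<close>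
    by (simp add: integral_unique)
  then have lemma_bound: "(\<integral>\<^sup>+x. exp (l * (\<mu> - f x)) \<partial>?U) \<le> ennreal (exp (l\<^sup>2 * (M - m)\<^sup>2 / 8))"
    using Hoeffdings_lemma_below_mean[OF \<open>l > 0\<close>] by simp
  have "(\<integral>\<^sup>+x\<in>{a..b}. exp (l * (c - f x)) \<partial>lborel)
      = ennreal (b - a) * (\<integral>\<^sup>+x. exp (l * (c - f x)) \<partial>?U)"
    using \<open>a < b\<close> by (simp add: nn_integral_uniform_measure ennreal_times_divide
        ennreal_mult_divide_eq mult.commute[of "ennreal (b - a)"])
  also have "(\<integral>\<^sup>+x. exp (l * (c - f x)) \<partial>?U)
      = (\<integral>\<^sup>+x. ennreal (exp (l * (c - \<mu>))) * exp (l * (\<mu> - f x)) \<partial>?U)"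
    by (simp add: algebra_simps flip: exp_add ennreal_mult)
  also have "\<dots> = ennreal (exp (l * (c - \<mu>))) * (\<integral>\<^sup>+x. exp (l * (\<mu> - f x)) \<partial>?U)"
    by (rule nn_integral_cmult) measurable
  also have "ennreal (b - a) * \<dots> \<le>
      ennreal (b - a) * (ennreal (exp (l * (c - \<mu>))) * ennreal (exp (l\<^sup>2 * (M - m)\<^sup>2 / 8)))"
    by (intro mult_left_mono lemma_bound) auto
  also have "\<dots> = ennreal ((b - a) * exp (l * (c - \<mu>) + l\<^sup>2 * (M - m)\<^sup>2 / 8))"
    using \<open>a < b\<close> by (simp add: exp_add flip: ennreal_mult)
  finally show ?thesis .
qed

lemma norm_meas_low_sum_le_Hoeffding:
  fixes f :: "real \<Rightarrow> real"
  assumes f: "f \<in> borel_measurable borel"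
    and bounds: "\<And>x. x \<in> {-pi..pi} \<Longrightarrow> f x \<in> {m..M}" and "m < M"
    and mean: "(f has_integral 2 * pi * \<mu>) {-pi..pi}" and "c < \<mu>"
  shows "norm_meas (low_sum f c :: (real^'n) set)
    \<le> exp (- (2 * (\<mu> - c)\<^sup>2 / (M - m)\<^sup>2)) ^ CARD('n)"
proof (rule norm_meas_low_sum_le_chernoff[OF f])
  define l where "l = 4 * (\<mu> - c) / (M - m)\<^sup>2"
  have "l > 0" using assms by (simp add: l_def)
  then show "0 \<le> l" by simp
  have "l * d + l\<^sup>2 * D / 8 = - (2 * d\<^sup>2 / D)" if "l = - 4 * d / D" "D \<noteq> 0" for d D
    unfolding that(1) using that(2) by (simp add: power2_eq_square field_simps)
  from this[of "c - \<mu>" "(M - m)\<^sup>2"]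
  have "l * (c - \<mu>) + l\<^sup>2 * (M - m)\<^sup>2 / 8 = - (2 * (\<mu> - c)\<^sup>2 / (M - m)\<^sup>2)"
    using \<open>m < M\<close> by (simp add: l_def power2_commute[of c \<mu>])
  moreover have "(f has_integral (pi - - pi) * \<mu>) {-pi..pi}" using mean by simp
  ultimately show "(\<integral>\<^sup>+x\<in>{-pi..pi}. exp (l * (c - f x)) \<partial>lborel)
      \<le> ennreal (2 * pi * exp (- (2 * (\<mu> - c)\<^sup>2 / (M - m)\<^sup>2)))"
    using set_nn_integral_exp_le_Hoeffding[OF _ f bounds, of "- pi" pi \<mu> l c] \<open>l > 0\<close> by simp
qed simp

lemma borel_measurable_retained_order [measurable]: "retained_order \<alpha> \<in> borel_measurable borel"
  unfolding retained_order_def[abs_def] by measurable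

lemma retained_order_has_integral:
  assumes "0 \<le> \<alpha>" "\<alpha> \<le> pi/2"
  shows "(retained_order \<alpha> has_integral 2 * (pi - \<alpha> + \<alpha> * cos \<alpha>)) {-pi..pi}"
proof -
  have inner: "(retained_order \<alpha> has_integral \<alpha> * (1 + cos \<alpha>)) {0..\<alpha>}"
  proof (rule has_integral_eq)
    show "((\<lambda>x. 1 + cos \<alpha>) has_integral \<alpha> * (1 + cos \<alpha>)) {0..\<alpha>}"
      using has_integral_const_real[of "1 + cos \<alpha>" 0 \<alpha>] assms by simp
  qed (use assms in \<open>auto simp: retained_order_def max_def\<close>)
  have middle: "(retained_order \<alpha> has_integral pi - 2 * \<alpha>) {\<alpha>..pi - \<alpha>}"
  proof (rule has_integral_eq)
    have "((\<lambda>x. 1 + cos x) has_integral ((pi - \<alpha>) + sin (pi - \<alpha>)) - (\<alpha> + sin \<alpha>)) {\<alpha>..pi - \<alpha>}"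
      using assms by (intro fundamental_theorem_of_calculus)
        (auto intro!: derivative_eq_intros simp flip: has_real_derivative_iff_has_vector_derivative)
    then show "((\<lambda>x. 1 + cos x) has_integral pi - 2 * \<alpha>) {\<alpha>..pi - \<alpha>}" by simp
  qed (use assms in \<open>auto simp: retained_order_def max_def\<close>)
  have outer: "(retained_order \<alpha> has_integral 0) {pi - \<alpha>..pi}"
    by (rule has_integral_spike_finite[where S = "{pi - \<alpha>}" and f = "\<lambda>_. 0"])
       (use assms in \<open>auto simp: retained_order_def\<close>)
  have "(retained_order \<alpha> has_integral \<alpha> * (1 + cos \<alpha>) + (pi - 2 * \<alpha>)) {0..pi - \<alpha>}"
    by (rule has_integral_combine[OF _ _ inner middle]) (use assms in auto)
  then have "(retained_order \<alpha> has_integral \<alpha> * (1 + cos \<alpha>) + (pi - 2 * \<alpha>) + 0) {0..pi}"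
    by (rule has_integral_combine[rotated 2, OF _ outer]) (use assms in auto)
  then have right: "(retained_order \<alpha> has_integral pi - \<alpha> + \<alpha> * cos \<alpha>) {0..pi}"
    by (simp add: algebra_simps)
  have "((\<lambda>x. retained_order \<alpha> (- x)) has_integral pi - \<alpha> + \<alpha> * cos \<alpha>) {-pi..-0}"
    using right by (subst has_integral_reflect_real) auto
  moreover have "(\<lambda>x. retained_order \<alpha> (- x)) = retained_order \<alpha>"
    by (simp add: retained_order_def fun_eq_iff)
  ultimately have "(retained_order \<alpha> has_integral pi - \<alpha> + \<alpha> * cos \<alpha>) {-pi..0}" by simp
  from has_integral_combine[OF _ _ this right] show ?thesis by (simp add: algebra_simps)
qed

lemma norm_meas_low_sum_retained_order_le:
  assumes "0 < \<epsilon>" "\<epsilon> \<le> 1"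
  shows "norm_meas (low_sum (retained_order (pi/4)) (order_level \<epsilon>) :: (real^'n) set)
    \<le> exp (- (\<epsilon>\<^sup>2 / 25)) ^ CARD('n)"
proof -
  define \<mu> where "\<mu> = 3/4 + sqrt 2 / 8"
  define M where "M = 1 + cos (pi/4)"
  have "M\<^sup>2 = 3/2 + sqrt 2"
    by (simp add: M_def cos_45 power2_eq_square field_simps)
  then have M: "0 < M" "M\<^sup>2 \<le> 3" "0 < M\<^sup>2"
    using sqrt_2_less by (auto simp: M_def cos_45 add_pos_pos)
  have "order_level \<epsilon> = sqrt 2 / 2 - 3 * \<epsilon> / 20"
    by (simp add: order_level_def field_simps)
  then have gap: "\<epsilon> / 4 \<le> \<mu> - order_level \<epsilon>"
    using sqrt_2_less assms by (simp add: \<mu>_def)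
  have "norm_meas (low_sum (retained_order (pi/4)) (order_level \<epsilon>) :: (real^'n) set)
      \<le> exp (- (2 * (\<mu> - order_level \<epsilon>)\<^sup>2 / (M - 0)\<^sup>2)) ^ CARD('n)"
  proof (rule norm_meas_low_sum_le_Hoeffding)
    show "(retained_order (pi/4) has_integral 2 * pi * \<mu>) {-pi..pi}"
      using retained_order_has_integral[of "pi/4"] by (simp add: \<mu>_def cos_45 field_simps)
    show "retained_order (pi/4) x \<in> {0..M}" for x
      using retained_order_nonneg retained_order_upper[of "pi/4" x] by (simp add: M_def)
  qed (use gap assms M in auto)
  also have "\<dots> \<le> exp (- (\<epsilon>\<^sup>2 / 25)) ^ CARD('n)"
  proof (intro power_mono)
    have "\<epsilon>\<^sup>2 / 25 \<le> 2 * (\<epsilon> / 4)\<^sup>2 / 3" by (simp add: power_divide)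
    also have "\<dots> \<le> 2 * (\<mu> - order_level \<epsilon>)\<^sup>2 / M\<^sup>2"
      using gap assms M by (intro frac_le mult_left_mono power_mono) auto
    finally show "exp (- (2 * (\<mu> - order_level \<epsilon>)\<^sup>2 / (M - 0)\<^sup>2)) \<le> exp (- (\<epsilon>\<^sup>2 / 25))" by simp
  qed simp
  finally show ?thesis .
qed

subsection \<open>Gaussian bound for the cosine\<close>

lemma sin_half_ge:
  assumes "0 \<le> u" "u \<le> pi"
  shows "u / pi \<le> sin (u / 2)"
proof -
  have "concave_on {0..pi} sin"
    by (rule f''_le0_imp_concave[where f' = cos and f'' = "\<lambda>x. - sin x"])
       (auto intro!: derivative_eq_intros sin_ge_zero)
  from concave_onD[OF this, of "u / pi" 0 "pi/2"] show ?thesis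
    using assms by (simp add: field_simps)
qed

lemma one_plus_cos_ge:
  assumes "0 \<le> x" "x \<le> pi"
  shows "2 * ((pi - x) / pi)\<^sup>2 \<le> 1 + cos x"
proof -
  have "((pi - x) / pi)\<^sup>2 \<le> (sin ((pi - x) / 2))\<^sup>2"
    using assms by (intro power_mono sin_half_ge) auto
  also have "sin ((pi - x) / 2) = cos (x / 2)"
    by (simp add: diff_divide_distrib sin_diff)
  also have "2 * (cos (x / 2))\<^sup>2 = 1 + cos x"
    using cos_double_cos[of "x / 2"] by simp
  finally show ?thesis by simp
qed

lemma nn_integral_abs:
  fixes f :: "real \<Rightarrow> ennreal"
  assumes [measurable]: "f \<in> borel_measurable borel"
  shows "(\<integral>\<^sup>+x. f \<bar>x\<bar> \<partial>lborel) = 2 * (\<integral>\<^sup>+x\<in>{0..}. f x \<partial>lborel)"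
proof -
  have "AE x in lborel. f \<bar>x\<bar> = f x * indicator {0..} x + f (- x) * indicator {0..} (- x)"
    using AE_lborel_singleton[of 0] by eventually_elim (auto simp: indicator_def)
  then have "(\<integral>\<^sup>+x. f \<bar>x\<bar> \<partial>lborel)
      = (\<integral>\<^sup>+x. f x * indicator {0..} x + f (- x) * indicator {0..} (- x) \<partial>lborel)"
    by (rule nn_integral_cong_AE)
  also have "\<dots> = (\<integral>\<^sup>+x\<in>{0..}. f x \<partial>lborel) + (\<integral>\<^sup>+x. f (- x) * indicator {0..} (- x) \<partial>lborel)"
    by (rule nn_integral_add) measurable
  also have "(\<integral>\<^sup>+x. f (- x) * indicator {0..} (- x) \<partial>lborel) = (\<integral>\<^sup>+x\<in>{0..}. f x \<partial>lborel)"
    using nn_integral_real_affine[of "\<lambda>x. f x * indicator {0..} x" "-1" 0] by simp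
  finally show ?thesis by (simp add: mult_2)
qed

lemma set_nn_integral_abs:
  fixes f :: "real \<Rightarrow> ennreal"
  assumes [measurable]: "f \<in> borel_measurable borel"
  shows "(\<integral>\<^sup>+x\<in>{-a..a}. f \<bar>x\<bar> \<partial>lborel) = 2 * (\<integral>\<^sup>+x\<in>{0..a}. f x \<partial>lborel)"
proof -
  have "(\<integral>\<^sup>+x\<in>{-a..a}. f \<bar>x\<bar> \<partial>lborel) = (\<integral>\<^sup>+x. f \<bar>x\<bar> * indicator {..a} \<bar>x\<bar> \<partial>lborel)"
    by (intro nn_integral_cong) (auto simp: indicator_def)
  also have "\<dots> = 2 * (\<integral>\<^sup>+x\<in>{0..}. f x * indicator {..a} x \<partial>lborel)"
    by (rule nn_integral_abs) measurable
  also have "(\<integral>\<^sup>+x\<in>{0..}. f x * indicator {..a} x \<partial>lborel) = (\<integral>\<^sup>+x\<in>{0..a}. f x \<partial>lborel)"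
    by (intro nn_integral_cong) (auto simp: indicator_def)
  finally show ?thesis .
qed

lemma nn_integral_normal_density_le_mean:
  assumes "\<sigma> > 0"
  shows "2 * (\<integral>\<^sup>+x\<in>{..\<mu>}. normal_density \<mu> \<sigma> x \<partial>lborel) = 1"
proof -
  have "(\<integral>\<^sup>+x\<in>{..\<mu>}. normal_density \<mu> \<sigma> x \<partial>lborel)
      = (\<integral>\<^sup>+x\<in>{0..}. normal_density 0 \<sigma> x \<partial>lborel)"
    using nn_integral_real_affine
      [of "\<lambda>x. ennreal (normal_density \<mu> \<sigma> x) * indicator {..\<mu>} x" "-1" \<mu>]
    by (simp add: normal_density_def indicator_def)
  then have "2 * (\<integral>\<^sup>+x\<in>{..\<mu>}. normal_density \<mu> \<sigma> x \<partial>lborel)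
      = (\<integral>\<^sup>+x. normal_density 0 \<sigma> \<bar>x\<bar> \<partial>lborel)"
    using nn_integral_abs[of "\<lambda>x. ennreal (normal_density 0 \<sigma> x)"] by simp
  also have "\<dots> = (\<integral>\<^sup>+x. normal_density 0 \<sigma> x \<partial>lborel)"
    by (simp add: normal_density_def)
  also have "\<dots> = 1"
    using assms by (subst nn_integral_eq_integral) auto
  finally show ?thesis .
qed

text \<open>The Chernoff parameter \<open>1 / (4 * q\<^sup>2)\<close> minimises the resulting Gaussian bound, which is
  proportional to \<open>exp (2 * q\<^sup>2 * l) / sqrt l\<close> as a function of the parameter \<open>l\<close>.\<close>

lemma exp_cos_le_normal_density:
  assumes "0 < q" "0 \<le> x" "x \<le> pi"
  shows "exp (1 / (4 * q\<^sup>2) * (2 * q\<^sup>2 - (1 + cos x)))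
    \<le> 2 * pi * (sqrt (pi * exp 1 / 2) * q) * normal_density pi (pi * q) x"
proof -
  have "exp (1 / (4 * q\<^sup>2) * (2 * q\<^sup>2 - (1 + cos x))) = exp (1/2 - (1 + cos x) / (4 * q\<^sup>2))"
    using assms by (simp add: field_simps)
  also have "\<dots> \<le> exp (1/2 - 2 * ((pi - x) / pi)\<^sup>2 / (4 * q\<^sup>2))"
    using divide_right_mono[OF one_plus_cos_ge[OF assms(2,3)], of "4 * q\<^sup>2"] by simp
  also have "\<dots> = exp (1/2) * exp (- (x - pi)\<^sup>2 / (2 * (pi * q)\<^sup>2))"
    by (simp add: power_divide power_mult_distrib power2_commute[of x pi] flip: exp_add)
  also have "exp (1/2) = sqrt (exp (1::real))"
    using exp_double[of "1/2 :: real"] by (simp add: real_sqrt_unique)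
  also have "sqrt (exp 1) = 2 * pi * (sqrt (pi * exp 1 / 2) * q) * (1 / sqrt (2 * pi * (pi * q)\<^sup>2))"
    using assms by (simp add: real_sqrt_mult real_sqrt_divide field_simps)
  finally show ?thesis by (simp add: normal_density_def)
qed

lemma norm_meas_low_sum_cos_le:
  assumes "q > 0"
  shows "norm_meas (low_sum (\<lambda>x. 1 + cos x) (2 * q\<^sup>2) :: (real^'n) set)
    \<le> (sqrt (pi * exp 1 / 2) * q) ^ CARD('n)"
proof (rule norm_meas_low_sum_le_chernoff)
  define f where "f x = ennreal (exp (1 / (4 * q\<^sup>2) * (2 * q\<^sup>2 - (1 + cos x))))" for x
  define C where "C = ennreal (2 * pi * (sqrt (pi * exp 1 / 2) * q))"
  have "(\<integral>\<^sup>+x\<in>{0..pi}. f x \<partial>lborel)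
      \<le> (\<integral>\<^sup>+x. C * (ennreal (normal_density pi (pi * q) x) * indicator {..pi} x) \<partial>lborel)"
    using assms exp_cos_le_normal_density[OF assms] unfolding f_def C_def
    by (intro nn_integral_mono) (auto simp: indicator_def simp flip: ennreal_mult)
  also have "\<dots> = C * (\<integral>\<^sup>+x\<in>{..pi}. normal_density pi (pi * q) x \<partial>lborel)"
    by (rule nn_integral_cmult) measurable
  finally have "2 * (\<integral>\<^sup>+x\<in>{0..pi}. f x \<partial>lborel)
      \<le> C * (2 * (\<integral>\<^sup>+x\<in>{..pi}. normal_density pi (pi * q) x \<partial>lborel))"
    by (subst mult.left_commute) (rule mult_left_mono, simp_all)
  also have "\<dots> = C"
    using nn_integral_normal_density_le_mean[of "pi * q" pi] assms by simp
  also have "2 * (\<integral>\<^sup>+x\<in>{0..pi}. f x \<partial>lborel) = (\<integral>\<^sup>+x\<in>{-pi..pi}. f \<bar>x\<bar> \<partial>lborel)"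
    unfolding f_def by (rule set_nn_integral_abs[symmetric]) measurable
  finally show "(\<integral>\<^sup>+x\<in>{-pi..pi}. exp (1 / (4 * q\<^sup>2) * (2 * q\<^sup>2 - (1 + cos x))) \<partial>lborel)
      \<le> ennreal (2 * pi * (sqrt (pi * exp 1 / 2) * q))"
    by (simp add: f_def C_def)
qed (use assms in auto)

subsection \<open>Measure of the good initial data\<close>

lemma norm_meas_coherent_ge:
  fixes \<omega> :: "real^'n"
  assumes "0 < \<kappa>" "0 < \<epsilon>" "\<epsilon> \<le> 1" "(2 + \<epsilon>) * Omega_inf \<omega> < \<kappa>"
  shows "1 - exp (- (\<epsilon>\<^sup>2 * real CARD('n) / 25))
    \<le> norm_meas (initial_data \<kappa> \<omega> (coherent (order_level \<epsilon>)))"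
proof -
  have "1 - exp (- (\<epsilon>\<^sup>2 * real CARD('n) / 25)) = 1 - exp (- (\<epsilon>\<^sup>2 / 25)) ^ CARD('n)"
    by (simp add: mult_ac flip: exp_of_nat_mult)
  also have "\<dots> \<le> 1 - norm_meas (low_sum (retained_order (pi/4)) (order_level \<epsilon>) :: (real^'n) set)"
    using norm_meas_low_sum_retained_order_le[OF assms(2,3)] by simp
  also have "\<dots> \<le> norm_meas (initial_data \<kappa> \<omega> (coherent (order_level \<epsilon>)))"
    using initial_data_in_borel[OF closed_under_limits_coherent] borel_measurable_retained_order
  proof (rule norm_meas_initial_data_ge)
    fix x \<theta>
    assume "real CARD('n) * order_level \<epsilon> < (\<Sum>i\<in>UNIV. retained_order (pi/4) (x $ i))"
      and "is_solution \<kappa> \<omega> x \<theta>"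
    then show "coherent (order_level \<epsilon>) \<theta>"
      using kuramoto_solution.coherent_if_retained_order kuramoto_solution_order_level assms by blast
  qed
  finally show ?thesis .
qed

lemma norm_meas_osc_bounded_ge:
  fixes \<omega> :: "real^'n"
  assumes "0 < \<kappa>" "0 < q" "q < 1" "Omega_inf \<omega> \<le> \<kappa> * q ^ 3"
  shows "1 - (sqrt (pi * exp 1 / 2) * q) ^ CARD('n)
    \<le> norm_meas (initial_data \<kappa> \<omega> (\<lambda>\<theta>. \<forall>i. osc_bounded \<theta> i))"
proof -
  have "1 - (sqrt (pi * exp 1 / 2) * q) ^ CARD('n)
      \<le> 1 - norm_meas (low_sum (\<lambda>x. 1 + cos x) (2 * q\<^sup>2) :: (real^'n) set)"
    using norm_meas_low_sum_cos_le[OF assms(2)] by simp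
  also have "\<dots> \<le> norm_meas (initial_data \<kappa> \<omega> (\<lambda>\<theta>. \<forall>i. osc_bounded \<theta> i))"
    using osc_bounded_if_initially_spread assms
    by (intro norm_meas_initial_data_ge initial_data_osc_bounded_in_borel) auto
  finally show ?thesis .
qed

text \<open>Passing to the limit from above covers \<open>Omega_inf \<omega> = 0\<close> as well, where \<open>q = 0\<close>.\<close>

lemma norm_meas_osc_bounded_ge_powr:
  fixes \<omega> :: "real^'n"
  assumes "0 < \<kappa>" "Omega_inf \<omega> < \<kappa>"
  shows "1 - (sqrt (pi * exp 1 / 2) * Omega_inf \<omega> powr (1/3) / \<kappa> powr (1/3)) ^ CARD('n)
    \<le> norm_meas (initial_data \<kappa> \<omega> (\<lambda>\<theta>. \<forall>i. osc_bounded \<theta> i))" (is "_ \<le> ?m")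
proof -
  define q where "q = Omega_inf \<omega> powr (1/3) / \<kappa> powr (1/3)"
  have "(y powr (1/3)) ^ 3 = y" if "0 \<le> y" for y :: real
    using that root_powr_inverse[of 3 y] real_root_pow_pos2[of 3 y] by simp
  then have cube: "q ^ 3 = Omega_inf \<omega> / \<kappa>"
    using assms(1) Omega_inf_nonneg[of \<omega>] by (simp add: q_def power_divide)
  have "0 \<le> q" by (simp add: q_def)
  have "q < 1"
    using assms by (intro power_less_imp_less_base[of q 3]) (simp_all add: cube)
  have eventually: "\<forall>\<^sub>F p in at_right q. 1 - (sqrt (pi * exp 1 / 2) * p) ^ CARD('n) \<le> ?m"
    using eventually_at_right_real[OF \<open>q < 1\<close>]
  proof eventually_elim
    case (elim p)
    then have "q ^ 3 \<le> p ^ 3" using \<open>0 \<le> q\<close> by (intro power_mono) auto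
    then have "Omega_inf \<omega> \<le> \<kappa> * p ^ 3"
      using assms(1) by (simp add: cube field_simps)
    then show ?case
      using elim \<open>0 \<le> q\<close> assms(1) by (intro norm_meas_osc_bounded_ge) auto
  qed
  have limit: "((\<lambda>p. 1 - (sqrt (pi * exp 1 / 2) * p) ^ CARD('n)) \<longlongrightarrow>
      1 - (sqrt (pi * exp 1 / 2) * q) ^ CARD('n)) (at_right q)"
    by (intro tendsto_intros)
  have "1 - (sqrt (pi * exp 1 / 2) * q) ^ CARD('n) \<le> ?m"
    by (rule tendsto_upperbound[OF limit eventually]) simp
  then show ?thesis by (simp add: q_def)
qed

theorem theorem1p6:
  fixes \<omega> :: "real^'n" and \<kappa> \<epsilon> :: real
  assumes "\<kappa> > 0" and "0 < \<epsilon>" and "\<epsilon> \<le> 1"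
    and "\<kappa> > (2 + \<epsilon>) * Omega_inf \<omega>"
  shows "(let S = {\<theta>0 \<in> cube. \<forall>\<theta>. is_solution \<kappa> \<omega> \<theta>0 \<theta> \<longrightarrow>
              (\<forall>t\<ge>0. order_R \<theta> t \<ge> 1 / sqrt 2 - 3 * \<epsilon> / 20)
            \<and> (\<forall>i. osc_bounded \<theta> i)
            \<and> (\<forall>i. \<forall>t0\<ge>0. cos (\<theta> t0 $ i) \<ge> - 1 / sqrt 2 \<longrightarrow>
                  (\<forall>t\<ge>t0. cos (\<theta> t $ i) \<ge> - 1 / sqrt 2) \<and>
                  (\<forall>t\<ge>t0 + (2 + \<epsilon>) * pi / (\<kappa> - (2 + \<epsilon>) * Omega_inf \<omega>).
                      cos (\<theta> t $ i) \<ge> 1 / sqrt 2))}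
         in S \<in> sets lebesgue \<and>
            norm_meas S \<ge> 1 - exp (- (\<epsilon>^2 * real CARD('n) / 25)))
       \<and> (\<kappa> > (pi * exp 1 / 2) powr (3/2) * Omega_inf \<omega> \<longrightarrow>
          (let S = {\<theta>0 \<in> cube. \<forall>\<theta>. is_solution \<kappa> \<omega> \<theta>0 \<theta> \<longrightarrow> (\<forall>i. osc_bounded \<theta> i)}
           in S \<in> sets lebesgue \<and>
              norm_meas S \<ge> 1 - (sqrt (pi * exp 1 / 2) * Omega_inf \<omega> powr (1/3)
                                   / \<kappa> powr (1/3)) ^ CARD('n)))"
proof -
  let ?coherent = "initial_data \<kappa> \<omega> (coherent (order_level \<epsilon>))"
  let ?confined = "initial_data \<kappa> \<omega> (\<lambda>\<theta>. \<forall>i. osc_bounded \<theta> i)"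
  have "?coherent \<in> sets lebesgue" "?confined \<in> sets lebesgue"
    by (auto intro!: sets_completionI_sets initial_data_in_borel closed_under_limits_coherent
        initial_data_osc_bounded_in_borel)
  moreover have "1 - exp (- (\<epsilon>\<^sup>2 * real CARD('n) / 25)) \<le> norm_meas ?coherent"
    by (rule norm_meas_coherent_ge) fact+
  moreover have "Omega_inf \<omega> < \<kappa>"
    using assms mult_right_mono[OF _ Omega_inf_nonneg, of 1 "2 + \<epsilon>" \<omega>] by simp
  then have "1 - (sqrt (pi * exp 1 / 2) * Omega_inf \<omega> powr (1/3) / \<kappa> powr (1/3)) ^ CARD('n)
      \<le> norm_meas ?confined"
    by (rule norm_meas_osc_bounded_ge_powr[OF assms(1)])
  ultimately show ?thesis
    unfolding initial_data_conditions_eq[OF assms, symmetric]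
    by (simp add: Let_def initial_data_def coherent_def phases_trapped_def trapping_time_def
        order_level_def)
qed

end
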